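(* Let $n\ge 4$, let $s_i=(i,i+1)\in S_n$, and let $\pi$ be a real representation of $S_n$. Put $g_\pi=\frac{\chi_\pi(1)-\chi_\pi(s_1)}{2}$ and $h_\pi=\frac{\chi_\pi(1)-\chi_\pi(s_1s_3)}{2}$. The following are equivalent: \begin{enumerate} \item $\pi$ is spinorial; \item $g_\pi\equiv 0$ or $3\pmod 4$, and $h_\pi\equiv 0\pmod 4$; \item $\chi_\pi(1)-\chi_\pi(s_1)\equiv 0$ or $6\pmod 8$, and $\chi_\pi(1)\equiv\chi_\pi(s_1s_3)\pmod 8$. \end{enumerate} Moreover, when $\pi$ is spinorial it has exactly two lifts.
   Context: A real representation of a finite group $G$ on a Euclidean space $V$ is regarded as a homomorphism $\pi:G\to\mathrm{O}(V)$; $\chi_\pi$ is its character. $\mathrm{Pin}(V)$ is the Pin group of $V$ (constructed from the Clifford algebra with $v^2=-|v|^2$), with the standard double cover $\rho:\mathrm{Pin}(V)\to\mathrm{O}(V)$ of kernel $\{\pm1\}$. $\pi$ is spinorial if there exists a homomorphism $\hat\pi:G\to\mathrm{Pin}(V)$ with $\rho\circ\hat\pi=\pi$; such $\hat\pi$ is called a lift of $\pi$. *)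

theory Defs
  imports "HOL-Analysis.Analysis" "HOL-Combinatorics.Transposition" "HOL-Library.FuncSet"
begin

definition Sym :: "nat \<Rightarrow> (nat \<Rightarrow> nat) set" where
  "Sym n = {p. p permutes {1..n}}"

definition s_gen :: "nat \<Rightarrow> nat \<Rightarrow> nat" where
  "s_gen i = Transposition.transpose i (i + 1)"

definition orth_rep :: "nat \<Rightarrow> ((nat \<Rightarrow> nat) \<Rightarrow> real^'d^'d) \<Rightarrow> bool" where
  "orth_rep n \<pi> \<longleftrightarrow>
     (\<forall>g\<in>Sym n. orthogonal_matrix (\<pi> g)) \<and>
     (\<forall>g\<in>Sym n. \<forall>h\<in>Sym n. \<pi> (g \<circ> h) = \<pi> g ** \<pi> h)"

definition character :: "((nat \<Rightarrow> nat) \<Rightarrow> real^'d^'d) \<Rightarrow> (nat \<Rightarrow> nat) \<Rightarrow> real" where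
  "character \<pi> g = trace (\<pi> g)"

definition real_cong :: "real \<Rightarrow> int \<Rightarrow> int \<Rightarrow> bool" where
  "real_cong x a m \<longleftrightarrow> (\<exists>k::int. x = of_int a + of_int m * of_int k)"

section \<open>Clifford algebra Cl(V), V = real^'d, with v*v = -|v|^2\<close>

text \<open>Elements are coefficient functions on subsets A of the index set ('d) of the standard
  orthonormal basis; A stands for the basis monomial e_{a1} ... e_{ak}, a1 < ... < ak.\<close>

type_synonym 'd cliff = "'d set \<Rightarrow> real"

definition cl_sign :: "'d::{finite,linorder} set \<Rightarrow> 'd set \<Rightarrow> real" where
  "cl_sign A B = (-1) ^ card {(a, b). a \<in> A \<and> b \<in> B \<and> b < a} * (-1) ^ card (A \<inter> B)"

definition cl_mult :: "(('d::{finite,linorder}) set \<Rightarrow> real) \<Rightarrow> 'd cliff \<Rightarrow> 'd cliff" where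
  "cl_mult x y = (\<lambda>C. \<Sum>A\<in>UNIV. \<Sum>B\<in>UNIV.
      if (A - B) \<union> (B - A) = C then cl_sign A B * x A * y B else 0)"

definition cl_one :: "'d cliff" where
  "cl_one = (\<lambda>A. if A = {} then 1 else 0)"

definition cl_vec :: "real^'d \<Rightarrow> 'd cliff" where
  "cl_vec v = (\<lambda>A. if (\<exists>i. A = {i}) then v $ (the_elem A) else 0)"

definition cl_alpha :: "(('d::finite) set \<Rightarrow> real) \<Rightarrow> 'd cliff" where
  "cl_alpha x = (\<lambda>A. (-1) ^ card A * x A)"

definition cl_inv :: "(('d::{finite,linorder}) set \<Rightarrow> real) \<Rightarrow> 'd cliff" where
  "cl_inv x = (THE y. cl_mult x y = cl_one \<and> cl_mult y x = cl_one)"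

definition Pin :: "(('d::{finite,linorder}) set \<Rightarrow> real) set" where
  "Pin = {foldr cl_mult (map cl_vec us) cl_one | us. \<forall>u\<in>set us. norm u = 1}"

definition rho :: "('d set \<Rightarrow> real) \<Rightarrow> ((real, 'd::{finite,linorder}) vec, 'd) vec" where
  "rho x = (\<chi> i. \<chi> j. cl_mult (cl_mult (cl_alpha x) (cl_vec (axis j 1))) (cl_inv x) {i})"

definition is_lift :: "nat \<Rightarrow> ((nat \<Rightarrow> nat) \<Rightarrow> ((real, 'd::{finite,linorder}) vec, 'd) vec) \<Rightarrow> ((nat \<Rightarrow> nat) \<Rightarrow> 'd cliff) \<Rightarrow> bool" where
  "is_lift n \<pi> f \<longleftrightarrow>
     (\<forall>g\<in>Sym n. f g \<in> Pin) \<and>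
     (\<forall>g\<in>Sym n. \<forall>h\<in>Sym n. f (g \<circ> h) = cl_mult (f g) (f h)) \<and>
     (\<forall>g\<in>Sym n. rho (f g) = \<pi> g)"

definition spinorial :: "nat \<Rightarrow> ((nat \<Rightarrow> nat) \<Rightarrow> ((real, 'd::{finite,linorder}) vec, 'd) vec) \<Rightarrow> bool" where
  "spinorial n \<pi> \<longleftrightarrow> (\<exists>f::(nat \<Rightarrow> nat) \<Rightarrow> 'd cliff. is_lift n \<pi> f)"

definition lifts :: "nat \<Rightarrow> ((nat \<Rightarrow> nat) \<Rightarrow> ((real, 'd::{finite,linorder}) vec, 'd) vec) \<Rightarrow> ((nat \<Rightarrow> nat) \<Rightarrow> 'd cliff) set" where
  "lifts n \<pi> = {f \<in> extensional (Sym n). is_lift n \<pi> f}"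

end

theory Submission
  imports Defs
begin

text \<open>
  An orthogonal involution whose \<open>-1\<close>-eigenspace has dimension \<open>k\<close> is the product of the
  reflections in an orthonormal basis \<open>b\<^sub>1, \<dots>, b\<^sub>k\<close> of this eigenspace, so its two lifts to the Pin
  group are \<open>\<plusminus> b\<^sub>1 \<cdots> b\<^sub>k\<close>. They have square \<open>(-1)^(k(k+1)/2)\<close> and parity \<open>(-1)^k\<close>. Hence lifts
  of the transpositions are involutions iff \<open>g \<equiv> 0, 3 (mod 4)\<close>. The number \<open>h\<close> is even, because the
  product of two lifts of conjugate transpositions is an even element, so lifts of commuting
  generators commute iff \<open>h \<equiv> 0 (mod 4)\<close>. The braid relations can always be achieved by
  adjusting signs, and the Coxeter presentation of the symmetric group then gives a lift. A lift
  is determined by its value on \<open>s\<^sub>1\<close>, and the only freedom is a twist by the sign character.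
\<close>

section \<open>The Clifford algebra as a ring\<close>

text \<open>The covering is given by coefficient functions, a definite description for inverses, and
  a matrix read off from singleton coefficients. On Pin the inverse turns out to be Clifford
  conjugation, which is defined coefficientwise on the whole algebra; after this identification all
  arguments are computations in a ring. Lifts are only determined up to sign, but the square of a
  lift and its eigenvalue under the grade involution do not change under x \<mapsto> -x. They are
  therefore invariants of the orthogonal matrix, and even of its conjugacy class, which is why two
  numbers control all generators and all commuting pairs. For lifts x, y of square 1, (xy)^2 = 1
  says exactly that xy = yx. The exponent k(k+1)/2 is even for k \<equiv> 0, 3 (mod 4), and evenness
  of h discards the residue 3. The homomorphism given by the Coxeter relations is defined directly
  on permutations, by a normal form along the cosets of \<open>Sym n\<close> in
  \<open>Sym (Suc n)\<close>, so that no words have to be compared.\<close>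

definition inv_sign :: "'d::linorder \<Rightarrow> 'd \<Rightarrow> real" where
  "inv_sign a b = (if b \<le> a then -1 else 1)"

text \<open>Factors over the intersection occur twice on the right and square to 1. Such a product
  is thus a character of the group of subsets under symmetric difference, which gives both the
  bimultiplicativity of \<open>cl_sign\<close> and the multiplicativity of the parity sign.\<close>

lemma prod_sym_diff:
  fixes f :: "'a::finite \<Rightarrow> 'b::comm_monoid_mult"
  assumes "\<And>a. f a * f a = 1"
  shows "prod f (sym_diff A B) = prod f A * prod f B"
proof -
  have 1: "prod f A = prod f (A - B) * prod f (A \<inter> B)"
    by (subst prod.union_disjoint[symmetric]) (auto intro: arg_cong[where f="prod f"])
  have 2: "prod f B = prod f (B - A) * prod f (A \<inter> B)"
    by (subst prod.union_disjoint[symmetric]) (auto intro: arg_cong[where f="prod f"])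
  have 3: "prod f (A \<inter> B) * prod f (A \<inter> B) = 1"
    by (simp add: prod.distrib[symmetric] assms)
  have "prod f A * prod f B = prod f (A - B) * prod f (B - A) * (prod f (A \<inter> B) * prod f (A \<inter> B))"
    unfolding 1 2 by (simp only: ac_simps)
  also have "\<dots> = prod f (A - B) * prod f (B - A)" by (simp add: 3)
  also have "\<dots> = prod f (sym_diff A B)"
    by (subst prod.union_disjoint) auto
  finally show ?thesis ..
qed

lemma prod_inv_sign:
  "(\<Prod>p\<in>S. inv_sign (fst p) (snd p)) = (-1) ^ card {p\<in>S. snd p \<le> fst p}"
  if "finite S"
  using that
proof (induction S rule: finite_induct)
  case (insert x F)
  have "{p \<in> insert x F. snd p \<le> fst p} =
    (if snd x \<le> fst x then insert x {p\<in>F. snd p \<le> fst p} else {p\<in>F. snd p \<le> fst p})"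
    by auto
  with insert show ?case by (simp add: inv_sign_def)
qed simp

text \<open>\<open>inv_sign\<close> counts a = b as an inversion. The factor for inversions and the
  factor for the squares e_a^2 = -1 therefore merge into one product over pairs, which is
  multiplicative in each argument.\<close>

lemma cl_sign_eq_prod: "cl_sign A B = (\<Prod>a\<in>A. \<Prod>b\<in>B. inv_sign a b)"
proof -
  have "(\<Prod>a\<in>A. \<Prod>b\<in>B. inv_sign a b) = (\<Prod>p\<in>A \<times> B. inv_sign (fst p) (snd p))"
    by (simp add: prod.cartesian_product case_prod_beta)
  also have "\<dots> = (-1) ^ card {p\<in>A \<times> B. snd p \<le> fst p}"
    by (rule prod_inv_sign) simp
  also have "{p\<in>A \<times> B. snd p \<le> fst p} =
      {(a, b). a \<in> A \<and> b \<in> B \<and> b < a} \<union> (\<lambda>a. (a, a)) ` (A \<inter> B)"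
    by (auto simp: image_iff order_le_less)
  also have "card \<dots> = card {(a, b). a \<in> A \<and> b \<in> B \<and> b < a} + card (A \<inter> B)"
    by (subst card_Un_disjoint) (auto intro: card_image inj_onI)
  finally show ?thesis by (simp add: cl_sign_def power_add)
qed

lemma inv_sign_square: "inv_sign a b * inv_sign a b = 1"
  by (simp add: inv_sign_def)

lemma cl_sign_left: "cl_sign (sym_diff A B) C = cl_sign A C * cl_sign B C"
  unfolding cl_sign_eq_prod
  by (rule prod_sym_diff) (simp add: prod.distrib[symmetric] inv_sign_square)

lemma cl_sign_right: "cl_sign C (sym_diff A B) = cl_sign C A * cl_sign C B"
  unfolding cl_sign_eq_prod prod.distrib[symmetric]
  by (intro prod.cong refl prod_sym_diff) (simp add: inv_sign_square)

lemma cl_sign_square: "cl_sign A B * cl_sign A B = 1"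
  by (simp add: cl_sign_eq_prod prod.distrib[symmetric] inv_sign_square)

lemma cl_sign_square_left: "cl_sign A B * (cl_sign A B * z) = z"
  by (simp add: mult.assoc[symmetric] cl_sign_square)

lemma cl_sign_empty [simp]: "cl_sign {} A = 1" "cl_sign A {} = 1"
  by (simp_all add: cl_sign_eq_prod)

lemma cl_sign_singleton: "cl_sign {a} {b} = inv_sign a b"
  by (simp add: cl_sign_eq_prod)

text \<open>An element a \<noteq> i of A is inverted in exactly one of the two orders and
  contributes -1, whereas a = i contributes (-1)(-1) = 1; hence the correction when i \<in>
  A.\<close>

lemma cl_sign_commute:
  "cl_sign A {i} * cl_sign {i} A = (-1) ^ card A * (if i \<in> A then -1 else 1)"
proof -
  have "cl_sign A {i} * cl_sign {i} A = (\<Prod>a\<in>A. - (if a = i then -1 else 1))"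
    unfolding cl_sign_eq_prod by (auto simp: prod.distrib[symmetric] inv_sign_def intro!: prod.cong)
  also have "\<dots> = (-1) ^ card A * (\<Prod>a\<in>A. if a = i then -1 else 1)"
    by (simp add: prod_uminus)
  also have "(\<Prod>a\<in>A. if a = i then -1 else 1 :: real) = (if i \<in> A then -1 else 1)"
    by simp
  finally show ?thesis .
qed

section \<open>The product as a twisted convolution over subsets\<close>

lemma sym_diff_cancel [simp]: "sym_diff A (sym_diff A B) = B"
  by auto

lemma sum_sym_diff_reindex:
  fixes f :: "'a::finite set \<Rightarrow> 'b::comm_monoid_add"
  shows "(\<Sum>B\<in>UNIV. f (sym_diff A B)) = (\<Sum>B\<in>UNIV. f B)"
  by (rule sum.reindex_bij_witness[of _ "sym_diff A" "sym_diff A"]) auto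

text \<open>For fixed \<open>A\<close> the condition on \<open>B\<close> has the single solution
  \<open>sym_diff A C\<close>. This exhibits the algebra as the group algebra of subsets under
  symmetric difference, twisted by \<open>cl_sign\<close>.\<close>

lemma cl_mult_eq:
  "cl_mult x y C = (\<Sum>A\<in>UNIV. cl_sign A (sym_diff A C) * x A * y (sym_diff A C))"
  unfolding cl_mult_def
proof (rule sum.cong[OF refl])
  fix A
  have "(\<Sum>B\<in>UNIV. if sym_diff A B = C then cl_sign A B * x A * y B else 0)
    = (\<Sum>B\<in>UNIV. if B = sym_diff A C then cl_sign A B * x A * y B else 0)"
    by (rule sum.cong) auto
  then show "(\<Sum>B\<in>UNIV. if sym_diff A B = C then cl_sign A B * x A * y B else 0)
    = cl_sign A (sym_diff A C) * x A * y (sym_diff A C)"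
    by simp
qed

text \<open>A bimultiplicative sign is a 2-cocycle, so the twisted product is associative.\<close>

lemma cl_mult_assoc: "cl_mult (cl_mult x y) z = cl_mult x (cl_mult y z)"
proof
  fix D
  \<comment> \<open>\<open>E\<close> indexes the partial product of \<open>x\<close> and
    \<open>y\<close>, and \<open>A\<close> indexes \<open>x\<close>. Reindexing by
    \<open>sym_diff A E\<close> makes the index of \<open>y\<close> the summation variable.\<close>
  let ?f = "\<lambda>A E. cl_sign A A * cl_sign A E * cl_sign E E * cl_sign E D
      * x A * y (sym_diff A E) * z (sym_diff E D)"
  have "cl_mult (cl_mult x y) z D = (\<Sum>E\<in>UNIV. \<Sum>A\<in>UNIV. ?f A E)"
    by (simp add: cl_mult_eq sum_distrib_left sum_distrib_right cl_sign_right ac_simps)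
  also have "\<dots> = (\<Sum>A\<in>UNIV. \<Sum>E\<in>UNIV. ?f A E)"
    by (rule sum.swap)
  also have "\<dots> = cl_mult x (cl_mult y z) D"
    unfolding cl_mult_eq sum_distrib_left
  proof (rule sum.cong[OF refl])
    fix A
    let ?g = "\<lambda>B. cl_sign A (sym_diff A D) * x A *
       (cl_sign B (sym_diff B (sym_diff A D)) * y B * z (sym_diff B (sym_diff A D)))"
    have eq: "?f A E = ?g (sym_diff A E)" for E
    proof -
      have *: "sym_diff (sym_diff A E) (sym_diff A D) = sym_diff E D" by auto
      show ?thesis unfolding * cl_sign_right cl_sign_left
        by (simp add: ac_simps cl_sign_square_left)
    qed
    have "(\<Sum>E\<in>UNIV. ?f A E) = (\<Sum>E\<in>UNIV. ?g (sym_diff A E))"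
      by (rule sum.cong[OF refl]) (rule eq)
    then show "(\<Sum>E\<in>UNIV. ?f A E) = sum ?g UNIV"
      using sum_sym_diff_reindex[of ?g A] by (rule trans)
  qed
  finally show "cl_mult (cl_mult x y) z D = cl_mult x (cl_mult y z) D" .
qed

lemma cl_mult_one: "cl_mult cl_one x = x" "cl_mult x cl_one = x"
proof -
  show "cl_mult cl_one x = x"
  proof
    fix C
    have "cl_mult cl_one x C = (\<Sum>A\<in>UNIV. if A = {} then cl_sign A (sym_diff A C) * x (sym_diff A C) else 0)"
      unfolding cl_mult_eq cl_one_def by (rule sum.cong) auto
    then show "cl_mult cl_one x C = x C" by simp
  qed
  show "cl_mult x cl_one = x"
  proof
    fix C
    have *: "sym_diff A C = {} \<longleftrightarrow> A = C" for A :: "'a set" by auto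
    have "cl_mult x cl_one C = (\<Sum>A\<in>UNIV. if A = C then cl_sign A (sym_diff A C) * x A else 0)"
      unfolding cl_mult_eq cl_one_def * by (rule sum.cong) auto
    then show "cl_mult x cl_one C = x C" by simp
  qed
qed

text \<open>A type of its own can be made an instance of \<open>real_algebra_1\<close>, so that
  products, scalars and powers obey the ring laws in ordinary notation.\<close>

typedef 'd clifford = "UNIV :: ('d set \<Rightarrow> real) set"
  morphisms coeff Clifford ..

setup_lifting type_definition_clifford

instantiation clifford :: ("{finite,linorder}") real_algebra_1
begin

lift_definition zero_clifford :: "'a clifford" is "\<lambda>_. 0" .
lift_definition one_clifford :: "'a clifford" is cl_one .
lift_definition plus_clifford :: "'a clifford \<Rightarrow> 'a clifford \<Rightarrow> 'a clifford"
  is "\<lambda>x y A. x A + y A" .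
lift_definition minus_clifford :: "'a clifford \<Rightarrow> 'a clifford \<Rightarrow> 'a clifford"
  is "\<lambda>x y A. x A - y A" .
lift_definition uminus_clifford :: "'a clifford \<Rightarrow> 'a clifford" is "\<lambda>x A. - x A" .
lift_definition times_clifford :: "'a clifford \<Rightarrow> 'a clifford \<Rightarrow> 'a clifford" is cl_mult .
lift_definition scaleR_clifford :: "real \<Rightarrow> 'a clifford \<Rightarrow> 'a clifford"
  is "\<lambda>r x A. r * x A" .

instance
proof
  fix a b c :: "'a clifford" and r s :: real
  show "a * b * c = a * (b * c)" by transfer (rule cl_mult_assoc)
  show "1 * a = a" "a * 1 = a" by (transfer, rule cl_mult_one)+
  show "(0::'a clifford) \<noteq> 1" by transfer (auto simp: cl_one_def fun_eq_iff)
  show "(a + b) * c = a * c + b * c" "a * (b + c) = a * b + a * c"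
    by (transfer, simp add: cl_mult_eq fun_eq_iff algebra_simps sum.distrib)+
  show "r *\<^sub>R a * b = r *\<^sub>R (a * b)" "a * r *\<^sub>R b = r *\<^sub>R (a * b)"
    by (transfer, simp add: cl_mult_eq fun_eq_iff sum_distrib_left ac_simps)+
qed (transfer, simp add: fun_eq_iff algebra_simps)+

end

section \<open>Grade involution, conjugation and the embedding of vectors\<close>

lift_definition alpha :: "'d::{finite,linorder} clifford \<Rightarrow> 'd clifford" is cl_alpha .

text \<open>Clifford conjugation, the antiautomorphism with \<open>v \<mapsto> -v\<close>: on the monomial of an
  index set of size \<open>k\<close> it is the sign \<open>(-1)^(k(k+1)/2)\<close>, which is the value of
  \<^const>\<open>cl_sign\<close> on the diagonal.\<close>

lift_definition conj :: "'d::{finite,linorder} clifford \<Rightarrow> 'd clifford"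
  is "\<lambda>x A. cl_sign A A * x A" .

lift_definition vect :: "(real, 'd::{finite,linorder}) vec \<Rightarrow> 'd clifford" is cl_vec .

lift_definition monom :: "'d set \<Rightarrow> 'd::{finite,linorder} clifford"
  is "\<lambda>A B. if B = A then 1 else 0" .

lemma coeff_simps [simp]:
  "coeff 0 A = 0" "coeff (x + y) A = coeff x A + coeff y A"
  "coeff (x - y) A = coeff x A - coeff y A" "coeff (- x) A = - coeff x A"
  "coeff (r *\<^sub>R x) A = r * coeff x A"
  "coeff (alpha x) A = (-1) ^ card A * coeff x A"
  "coeff (conj x) A = cl_sign A A * coeff x A"
  by (transfer, simp add: cl_alpha_def)+

lemma coeff_sum [simp]: "coeff (sum f S) A = (\<Sum>i\<in>S. coeff (f i) A)"
  by (induction S rule: infinite_finite_induct) auto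

lemma coeff_one: "coeff 1 A = (if A = {} then 1 else 0)"
  by transfer (simp add: cl_one_def)

lemma clifford_eqI: "(\<And>A. coeff x A = coeff y A) \<Longrightarrow> x = y"
  by transfer auto

lemma coeff_times:
  "coeff (x * y) C = (\<Sum>A\<in>UNIV. cl_sign A (sym_diff A C) * coeff x A * coeff y (sym_diff A C))"
  by transfer (rule cl_mult_eq)

lemma alpha_times: "alpha (x * y) = alpha x * alpha y"
proof (rule clifford_eqI)
  fix C
  have *: "(-1) ^ card A * (-1) ^ card (sym_diff A C) = ((-1) ^ card C :: real)" for A :: "'a set"
    using prod_sym_diff[of "\<lambda>_. - 1 :: real" A "sym_diff A C"] by simp
  show "coeff (alpha (x * y)) C = coeff (alpha x * alpha y) C"
    unfolding coeff_simps coeff_times sum_distrib_left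
  proof (rule sum.cong[OF refl])
    fix A
    show "(-1) ^ card C * (cl_sign A (sym_diff A C) * coeff x A * coeff y (sym_diff A C)) =
      cl_sign A (sym_diff A C) * ((-1) ^ card A * coeff x A)
        * ((-1) ^ card (sym_diff A C) * coeff y (sym_diff A C))"
      unfolding *[of A, symmetric] by (simp only: ac_simps)
  qed
qed

lemma alpha_simps: "alpha 1 = 1" "alpha (- x) = - alpha x" "alpha (vect v) = - vect v"
  by (transfer, auto simp: cl_alpha_def cl_one_def cl_vec_def fun_eq_iff)+

text \<open>The substitution \<open>sym_diff C A\<close> exchanges the roles of the two factors.
  Bimultiplicativity expands \<open>cl_sign C C\<close> into the diagonal signs of both factors and
  two mixed signs, one for each order of the product.\<close>

lemma conj_times: "conj (x * y) = conj y * conj x"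
proof (rule clifford_eqI)
  fix C
  let ?f = "\<lambda>B. cl_sign B (sym_diff B C) * coeff (conj y) B * coeff (conj x) (sym_diff B C)"
  have "coeff (conj y * conj x) C = (\<Sum>A\<in>UNIV. ?f (sym_diff C A))"
    unfolding coeff_times by (rule sum_sym_diff_reindex[symmetric])
  also have "\<dots> = coeff (conj (x * y)) C"
    unfolding coeff_times coeff_simps sum_distrib_left
  proof (rule sum.cong[OF refl])
    fix A
    have 1: "sym_diff (sym_diff C A) C = A" "sym_diff C A = sym_diff A C"
      "sym_diff (sym_diff A C) C = A" by auto
    show "cl_sign (sym_diff C A) (sym_diff (sym_diff C A) C) *
      (cl_sign (sym_diff C A) (sym_diff C A) * coeff y (sym_diff C A)) *
      (cl_sign (sym_diff (sym_diff C A) C) (sym_diff (sym_diff C A) C) * coeff x (sym_diff (sym_diff C A) C)) =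
      cl_sign C C * (cl_sign A (sym_diff A C) * coeff x A * coeff y (sym_diff A C))"
      unfolding 1 cl_sign_left cl_sign_right
      by (simp add: ac_simps cl_sign_square_left)
  qed
  finally show "coeff (conj (x * y)) C = coeff (conj y * conj x) C" ..
qed

lemma conj_one: "conj 1 = 1"
  by (rule clifford_eqI) (simp add: coeff_one)

lemma conj_vect: "conj (vect v) = - vect v"
  by transfer (auto simp: cl_vec_def fun_eq_iff cl_sign_singleton inv_sign_def)

lemma linear_vect: "linear vect"
  by (rule linearI; transfer) (auto simp: cl_vec_def fun_eq_iff)

lemma vect_eq_sum: "vect v = (\<Sum>i\<in>UNIV. v $ i *\<^sub>R monom {i})"
proof (rule clifford_eqI)
  fix A
  have m: "coeff (monom {i}) A = (if {i} = A then 1 else 0)" for i :: 'a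
    by transfer auto
  have v: "coeff (vect v) A = (if \<exists>i. A = {i} then v $ the_elem A else 0)"
    by transfer (simp add: cl_vec_def)
  show "coeff (vect v) A = coeff (\<Sum>i\<in>UNIV. v $ i *\<^sub>R monom {i}) A"
  proof (cases "\<exists>i. A = {i}")
    case True
    then show ?thesis
      by (auto simp: v m if_distrib cong: if_cong)
  next
    case False
    then have "{i} \<noteq> A" for i by auto
    with False show ?thesis by (simp add: v m)
  qed
qed

lemma monom_times: "monom A * monom B = cl_sign A B *\<^sub>R monom (sym_diff A B)"
proof (rule clifford_eqI)
  fix C
  have m: "coeff (monom A) B = (if B = A then 1 else 0)" for A B :: "'a set"
    by transfer auto
  have *: "sym_diff A C = B \<longleftrightarrow> C = sym_diff A B" by auto
  have "coeff (monom A * monom B) C =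
      (\<Sum>A'\<in>UNIV. if A' = A then cl_sign A (sym_diff A C) * (if sym_diff A C = B then 1 else 0) else 0)"
    unfolding coeff_times m by (rule sum.cong) auto
  then show "coeff (monom A * monom B) C = coeff (cl_sign A B *\<^sub>R monom (sym_diff A B)) C"
    unfolding * by (simp add: m)
qed

lemma monom_empty: "monom {} = 1"
  by transfer (auto simp: cl_one_def fun_eq_iff)

text \<open>The polarised Clifford relation. By bilinearity it reduces to basis vectors: distinct
  ones anticommute and each squares to -1.\<close>

lemma vect_anticommute: "vect u * vect v + vect v * vect u = of_real (-2 * (u \<bullet> v))"
proof -
  have m: "monom {i} * monom {j} + monom {j} * monom {i} = (if i = j then -2 else 0)"
    for i j :: 'a
  proof (cases "i = j")
    case True
    then show ?thesis
      by (simp add: monom_times monom_empty cl_sign_singleton inv_sign_def)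
  next
    case False
    then have "sym_diff {j} {i} = sym_diff {i} {j}" by auto
    with False show ?thesis
      by (simp only: monom_times cl_sign_singleton inv_sign_def) auto
  qed
  have "vect u * vect v + vect v * vect u =
     (\<Sum>i\<in>UNIV. \<Sum>j\<in>UNIV. (u $ i * v $ j) *\<^sub>R (monom {i} * monom {j}))
     + (\<Sum>j\<in>UNIV. \<Sum>i\<in>UNIV. (u $ i * v $ j) *\<^sub>R (monom {j} * monom {i}))"
    by (simp add: vect_eq_sum sum_product mult.commute)
  also have "(\<Sum>j\<in>UNIV. \<Sum>i\<in>UNIV. (u $ i * v $ j) *\<^sub>R (monom {j} * monom {i} :: 'a clifford))
     = (\<Sum>i\<in>UNIV. \<Sum>j\<in>UNIV. (u $ i * v $ j) *\<^sub>R (monom {j} * monom {i}))"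
    by (rule sum.swap)
  also have "(\<Sum>i\<in>UNIV. \<Sum>j\<in>UNIV. (u $ i * v $ j) *\<^sub>R (monom {i} * monom {j} :: 'a clifford)) + \<dots>
     = (\<Sum>i\<in>UNIV. \<Sum>j\<in>UNIV. if i = j then (u $ i * v $ j) *\<^sub>R (-2) else 0)"
    unfolding sum.distrib[symmetric] scaleR_right_distrib[symmetric] m
    by (intro sum.cong refl) auto
  also have "\<dots> = of_real (-2 * (u \<bullet> v))"
    by (simp add: inner_vec_def scaleR_sum_left[symmetric] sum_negf)
      (simp add: scaleR_conv_of_real mult_2 mult_2_right)
  finally show ?thesis .
qed

lemma vect_square: "vect u * vect u = - of_real ((norm u)\<^sup>2)"
proof -
  have "vect u * vect u + vect u * vect u = 2 *\<^sub>R (- of_real ((norm u)\<^sup>2))"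
    unfolding vect_anticommute by (simp add: of_real_def power2_norm_eq_inner)
  then show ?thesis by (simp add: scaleR_2[symmetric] del: scaleR_minus_right)
qed

lemma vect_eq_iff: "vect u = vect v \<longleftrightarrow> u = v"
proof
  assume *: "vect u = vect v"
  have "coeff (vect w) {i} = w $ i" for w :: "(real, 'a) vec" and i by transfer (simp add: cl_vec_def)
  then show "u = v" using * by (metis vec_eq_iff)
qed simp

section \<open>The Pin group\<close>

text \<open>The same group as \<open>Pin\<close>, with rule induction in place of lists of unit
  vectors.\<close>

inductive_set PIN :: "'d::{finite,linorder} clifford set" where
  one: "1 \<in> PIN"
| step: "norm u = 1 \<Longrightarrow> x \<in> PIN \<Longrightarrow> vect u * x \<in> PIN"

lemma coeff_mult: "coeff (x * y) = cl_mult (coeff x) (coeff y)"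
  by (rule times_clifford.rep_eq)

lemma Pin_eq: "Pin = coeff ` PIN"
proof
  have "foldr cl_mult (map cl_vec us) cl_one \<in> coeff ` PIN" if "\<forall>u\<in>set us. norm u = 1" for us :: "(real, 'a) vec list"
    using that
  proof (induction us)
    case Nil
    show ?case using imageI[OF PIN.one, of coeff] by (simp add: one_clifford.rep_eq)
  next
    case (Cons u us)
    then obtain x where "x \<in> PIN" "foldr cl_mult (map cl_vec us) cl_one = coeff x" by auto
    with Cons.prems show ?case
      using imageI[OF PIN.step[of u x], of coeff] by (simp add: vect.rep_eq coeff_mult)
  qed
  then show "Pin \<subseteq> coeff ` (PIN :: 'a clifford set)" by (auto simp: Pin_def)
  have "coeff x \<in> Pin" if "x \<in> PIN" for x :: "'a clifford"
    using that
  proof induction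
    case one
    show ?case by (auto simp: Pin_def one_clifford.rep_eq intro: exI[of _ "[]"])
  next
    case (step u x)
    then obtain us where "coeff x = foldr cl_mult (map cl_vec us) cl_one" "\<forall>u\<in>set us. norm u = 1"
      by (auto simp: Pin_def)
    with step show ?case
      by (auto simp: Pin_def coeff_mult vect.rep_eq intro!: exI[of _ "u # us"])
  qed
  then show "coeff ` PIN \<subseteq> (Pin :: 'a cliff set)" by auto
qed

lemma PIN_times: "x \<in> PIN \<Longrightarrow> y \<in> PIN \<Longrightarrow> x * y \<in> PIN"
  by (induction rule: PIN.induct) (simp_all add: mult.assoc PIN.step)

lemma PIN_uminus:
  assumes "x \<in> PIN" shows "- x \<in> PIN"
proof -
  \<comment> \<open>Any basis vector serves, since the index type is inhabited; its square is
    -1.\<close>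
  let ?e = "axis undefined 1 :: (real, 'a) vec"
  have "vect ?e * (vect ?e * x) = - x"
    by (simp add: mult.assoc[symmetric] vect_square)
  moreover have "vect ?e * (vect ?e * x) \<in> PIN"
    using assms by (intro PIN.step) simp_all
  ultimately show ?thesis by simp
qed

lemma vect_PIN: "norm u = 1 \<Longrightarrow> vect u \<in> PIN"
  using PIN.step[OF _ PIN.one] by simp

lemma conj_PIN: "x \<in> PIN \<Longrightarrow> conj x \<in> PIN"
  by (induction rule: PIN.induct)
    (simp_all add: conj_one conj_times conj_vect PIN.one PIN_times PIN_uminus vect_PIN
      del: mult_minus_right)

text \<open>Conjugation reverses products and sends a unit vector u to -u, which is its inverse
  because u^2 = -1.\<close>

lemma PIN_conj_inverse:
  assumes "x \<in> PIN" shows "x * conj x = 1" "conj x * x = 1"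
proof -
  have "x * conj x = 1 \<and> conj x * x = 1"
    using assms
  proof induction
    case (step u x)
    have "vect u * x * conj (vect u * x) = - (vect u * (x * conj x) * vect u)"
      "conj (vect u * x) * (vect u * x) = - (conj x * (vect u * vect u) * x)"
      by (simp_all add: conj_times conj_vect mult.assoc)
    with step show ?case by (simp add: vect_square)
  qed (simp add: conj_one)
  then show "x * conj x = 1" "conj x * x = 1" by auto
qed

lemma PIN_cancel:
  assumes "x \<in> PIN"
  shows "x * y = x * z \<longleftrightarrow> y = z" "y * x = z * x \<longleftrightarrow> y = z"
proof -
  have 1: "conj x * (x * w) = w" for w
    by (simp only: mult.assoc[symmetric] PIN_conj_inverse[OF assms] mult_1_left)
  have 2: "(w * x) * conj x = w" for w
    by (simp only: mult.assoc PIN_conj_inverse[OF assms] mult_1_right)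
  show "x * y = x * z \<longleftrightarrow> y = z"
    by (metis 1)
  show "y * x = z * x \<longleftrightarrow> y = z"
    by (metis 2)
qed

lemma PIN_neq_uminus:
  assumes "x \<in> PIN" shows "x \<noteq> - x"
proof
  assume "x = - x"
  then have "2 *\<^sub>R x = 0" by (simp add: scaleR_2 eq_neg_iff_add_eq_0)
  then have "x = 0" by simp
  then show False using PIN_conj_inverse[OF assms] by simp
qed

text \<open>Discharges the definite description, two-sided inverses being unique. From here on
  \<open>rho\<close> is computed with \<open>conj\<close>.\<close>

lemma cl_inv_PIN:
  assumes "x \<in> PIN" shows "cl_inv (coeff x) = coeff (conj x)"
  unfolding cl_inv_def
proof (rule the_equality)
  show "cl_mult (coeff x) (coeff (conj x)) = cl_one \<and> cl_mult (coeff (conj x)) (coeff x) = cl_one"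
    by (simp add: coeff_mult[symmetric] PIN_conj_inverse[OF assms] one_clifford.rep_eq)
next
  fix y assume "cl_mult (coeff x) y = cl_one \<and> cl_mult y (coeff x) = cl_one"
  then have "coeff (x * Clifford y) = coeff 1"
    by (simp add: coeff_mult Clifford_inverse one_clifford.rep_eq)
  then have "x * Clifford y = x * conj x"
    by (simp add: coeff_inject PIN_conj_inverse[OF assms])
  then show "y = coeff (conj x)"
    by (metis PIN_cancel(1)[OF assms] Clifford_inverse UNIV_I)
qed

text \<open>This is the reflection in the hyperplane orthogonal to u. The twisted action of u is
  (-u) w (-u), so its two signs cancel.\<close>

lemma vect_sandwich: "norm u = 1 \<Longrightarrow> vect u * vect w * vect u = vect (w - (2 * (u \<bullet> w)) *\<^sub>R u)"
proof -
  assume u: "norm u = 1"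
  have "vect u * vect w = of_real (-2 * (u \<bullet> w)) - vect w * vect u"
    using vect_anticommute[of u w] by (simp only: eq_diff_eq)
  then have "vect u * vect w * vect u = of_real (-2 * (u \<bullet> w)) * vect u - vect w * (vect u * vect u)"
    by (simp only: left_diff_distrib mult.assoc)
  then show ?thesis
    by (simp add: vect_square u scaleR_conv_of_real[symmetric] linear_diff[OF linear_vect]
        linear_cmul[OF linear_vect] of_real_mult[symmetric] del: of_real_mult)
qed

text \<open>\<open>rho\<close> records only singleton coefficients of the images of basis vectors.
  Recovering the action from this matrix requires that vectors go to vectors, and linearly.\<close>

lemma PIN_twisted_conj:
  assumes "x \<in> PIN"
  shows "\<exists>f. linear f \<and> (\<forall>v. alpha x * vect v * conj x = vect (f v))"
  using assms
proof induction
  case one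
  show ?case by (intro exI[of _ "\<lambda>v. v"]) (simp add: alpha_simps conj_one linear_ident)
next
  case (step u x)
  then obtain f where f: "linear f" "\<And>v. alpha x * vect v * conj x = vect (f v)" by blast
  let ?g = "\<lambda>v. f v - (2 * (u \<bullet> f v)) *\<^sub>R u"
  have "linear ?g"
    by (rule linearI)
      (simp_all add: linear_add[OF f(1)] linear_cmul[OF f(1)] inner_add_right algebra_simps)
  moreover have "alpha (vect u * x) * vect v * conj (vect u * x) = vect (?g v)" for v
  proof -
    have "alpha (vect u * x) * vect v * conj (vect u * x) =
      vect u * (alpha x * vect v * conj x) * vect u"
      by (simp add: alpha_times conj_times alpha_simps conj_vect mult.assoc)
    then show ?thesis by (simp add: f vect_sandwich step)
  qed
  ultimately show ?case by blast
qed

lemma vect_rho: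
  assumes "x \<in> PIN" shows "vect (rho (coeff x) *v v) = alpha x * vect v * conj x"
proof -
  obtain f where f: "linear f" "\<And>v. alpha x * vect v * conj x = vect (f v)"
    using PIN_twisted_conj[OF assms] by blast
  have "rho (coeff x) = matrix f"
    unfolding rho_def matrix_def cl_inv_PIN[OF assms] alpha.rep_eq[symmetric] vect.rep_eq[symmetric]
      coeff_mult[symmetric] f by (simp add: vect.rep_eq cl_vec_def)
  then show ?thesis using matrix_vector_mul(2)[OF f(1)] by (simp add: f fun_eq_iff)
qed

lemma rho_eqI:
  assumes "x \<in> PIN" "\<And>v. alpha x * vect v * conj x = vect (T *v v)"
  shows "rho (coeff x) = T"
  by (metis assms vect_rho vect_eq_iff matrix_eq)

lemma rho_one: "rho (coeff 1) = mat 1"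
  by (rule rho_eqI) (simp_all add: PIN.one alpha_simps conj_one)

lemma rho_times: "x \<in> PIN \<Longrightarrow> y \<in> PIN \<Longrightarrow> rho (coeff (x * y)) = rho (coeff x) ** rho (coeff y)"
  by (rule rho_eqI)
    (simp_all add: PIN_times matrix_vector_mul_assoc[symmetric] vect_rho alpha_times conj_times mult.assoc)

lemma conj_uminus: "conj (- x) = - conj x"
  by (rule clifford_eqI) simp

lemma rho_uminus: "x \<in> PIN \<Longrightarrow> rho (coeff (- x)) = rho (coeff x)"
  by (rule rho_eqI) (simp_all add: PIN_uminus vect_rho alpha_simps conj_uminus)

section \<open>The kernel of the covering\<close>

lemma coeff_times_monom: "coeff (x * monom B) (sym_diff A B) = cl_sign A B * coeff x A"
proof -
  have *: "sym_diff A' (sym_diff A B) = B \<longleftrightarrow> A' = A" for A' by auto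
  have "coeff (x * monom B) (sym_diff A B) =
     (\<Sum>A'\<in>UNIV. if A' = A then cl_sign A B * coeff x A else 0)"
    unfolding coeff_times monom.rep_eq * by (rule sum.cong) (auto simp: *)
  then show ?thesis by simp
qed

lemma coeff_monom_times: "coeff (monom B * x) (sym_diff A B) = cl_sign B A * coeff x A"
proof -
  have *: "sym_diff B (sym_diff A B) = A" by auto
  have "coeff (monom B * x) (sym_diff A B) =
     (\<Sum>A'\<in>UNIV. if A' = B then cl_sign B A * coeff x A else 0)"
    unfolding coeff_times monom.rep_eq by (rule sum.cong) (auto simp: *)
  then show ?thesis by simp
qed

text \<open>For i \<in> A and v = e_i, compare coefficients at \<open>sym_diff A {i}\<close>: the
  parity sign from \<open>alpha\<close> cancels the one in \<open>cl_sign_commute\<close>, and the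
  remaining -1 makes the coefficient at A vanish. Without the twist the volume element would survive
  in odd dimension.\<close>

lemma twisted_central_imp_scalar:
  assumes "\<And>v. alpha x * vect v = vect v * x"
  shows "x = of_real (coeff x {})"
proof (rule clifford_eqI)
  fix A
  show "coeff x A = coeff (of_real (coeff x {})) A"
  proof (cases "A = {}")
    case False
    then obtain i where i: "i \<in> A" by auto
    have "vect (axis i 1) = monom {i}"
      by (simp add: vect_eq_sum axis_def if_distrib cong: if_cong)
        (simp add: if_distribR sum.delta cong: if_cong)
    with assms[of "axis i 1"] have *: "alpha x * monom {i} = monom {i} * x" by simp
    have eq: "cl_sign A {i} * ((-1) ^ card A * coeff x A) = cl_sign {i} A * coeff x A"
      using arg_cong[OF *, of "\<lambda>z. coeff z (sym_diff A {i})"]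
      unfolding coeff_times_monom coeff_monom_times by simp
    have "cl_sign {i} A * cl_sign A {i} * ((-1) ^ card A * coeff x A) = coeff x A"
      by (simp only: mult.assoc eq cl_sign_square_left)
    then have "(-1) ^ card A * (-1) ^ card A * - coeff x A = coeff x A"
      using cl_sign_commute[of A i] i by (simp add: ac_simps)
    then have "coeff x A = 0" by (simp add: power_add[symmetric])
    then show ?thesis using False by (simp add: of_real_def coeff_one)
  qed (simp add: of_real_def coeff_one)
qed

text \<open>The element \<open>x * conj y\<close> acts trivially, hence is a scalar r. Conjugation
  fixes scalars and inverts elements of \<open>PIN\<close>, so r^2 = 1.\<close>

lemma rho_eq_imp:
  assumes x: "x \<in> PIN" and y: "y \<in> PIN" and "rho (coeff x) = rho (coeff y)"
  shows "x = y \<or> x = - y"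
proof -
  let ?z = "x * conj y"
  have cy: "conj y \<in> PIN" and z: "?z \<in> PIN" using x y by (auto intro: PIN_times conj_PIN)
  have "rho (coeff ?z) = rho (coeff (y * conj y))"
    by (simp only: rho_times x y cy assms(3))
  then have r: "rho (coeff ?z) = mat 1" by (simp add: PIN_conj_inverse y rho_one)
  have "alpha ?z * vect v = vect v * ?z" for v
  proof -
    have "alpha ?z * vect v * conj ?z * ?z = vect v * ?z"
      using vect_rho[OF z, of v] by (simp only: r matrix_vector_mul_lid)
    then show ?thesis by (simp only: mult.assoc PIN_conj_inverse[OF z] mult_1_right)
  qed
  then obtain r where c: "?z = of_real r" using twisted_central_imp_scalar by blast
  have "conj (of_real r :: 'a clifford) = of_real r"
    by (rule clifford_eqI) (simp add: of_real_def coeff_one)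
  then have "of_real (r * r) = (of_real 1 :: 'a clifford)"
    using PIN_conj_inverse(1)[OF z] by (simp add: c)
  then have "r * r = 1" by (simp only: of_real_eq_iff)
  then have "r = 1 \<or> r = - 1" by (simp add: square_eq_1_iff)
  moreover have "x = ?z * y" by (simp only: mult.assoc PIN_conj_inverse y mult_1_right)
  ultimately show ?thesis unfolding c by auto
qed

section \<open>Lifts of orthogonal involutions\<close>

lemma vect_orthogonal_commute:
  assumes "orthogonal u v" shows "vect u * vect v = - (vect v * vect u)"
  using vect_anticommute[of u v] assms by (simp add: orthogonal_def eq_neg_iff_add_eq_0)

lemma vect_commute_prod:
  assumes "\<forall>u\<in>set us. orthogonal w u"
  shows "prod_list (map vect us) * vect w = (-1) ^ length us * (vect w * prod_list (map vect us))"
  using assms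
proof (induction us)
  case (Cons u us)
  let ?x = "prod_list (map vect us)"
  have "vect u * ?x * vect w = vect u * ((-1) ^ length us * (vect w * ?x))"
    using Cons by (simp add: mult.assoc)
  also have "\<dots> = (-1) ^ length us * (vect u * vect w * ?x)"
    by (cases "even (length us)") (simp_all add: mult.assoc)
  also have "vect u * vect w = - (vect w * vect u)"
    using Cons by (intro vect_orthogonal_commute) (auto simp: orthogonal_commute)
  finally show ?case by (simp add: mult.assoc)
qed simp

lemma prod_list_PIN: "\<forall>u\<in>set us. norm u = 1 \<Longrightarrow> prod_list (map vect us) \<in> PIN"
  by (induction us) (auto intro: PIN.intros)

text \<open>Moving the first vector past k orthogonal ones costs (-1)^k and its square is -1. The
  exponent thus grows by k + 1 and runs through the triangular numbers.\<close>

lemma prod_list_square: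
  assumes "\<forall>u\<in>set us. norm u = 1" "sorted_wrt orthogonal us"
  shows "prod_list (map vect us) * prod_list (map vect us)
    = (-1) ^ (length us * (length us + 1) div 2)"
  using assms
proof (induction us)
  case (Cons u us)
  let ?x = "prod_list (map vect us)" and ?k = "length us"
  have "vect u * ?x * (vect u * ?x) = vect u * (?x * vect u) * ?x"
    by (simp add: mult.assoc)
  also have "?x * vect u = (-1) ^ ?k * (vect u * ?x)"
    using Cons by (intro vect_commute_prod) auto
  also have "vect u * ((-1) ^ ?k * (vect u * ?x)) * ?x = (-1) ^ ?k * ((vect u * vect u) * (?x * ?x))"
    by (cases "even ?k") (simp_all add: mult.assoc)
  also have "\<dots> = (-1) ^ (Suc ?k + ?k * (?k + 1) div 2)"
    using Cons by (simp add: vect_square power_add)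
  also have "Suc ?k + ?k * (?k + 1) div 2 = Suc ?k * (Suc ?k + 1) div 2"
  proof -
    have eq: "Suc ?k * (Suc ?k + 1) = ?k * (?k + 1) + 2 * Suc ?k" by simp
    show ?thesis unfolding eq by (subst div_mult_self2) (rule zero_neq_numeral[symmetric], rule refl)
  qed
  finally show ?case by simp
qed simp

lemma alpha_prod_list: "alpha (prod_list (map vect us)) = (-1) ^ length us * prod_list (map vect us)"
proof (induction us)
  case (Cons u us)
  then show ?case
    by (cases "even (length us)") (simp_all add: alpha_times alpha_simps)
qed (simp add: alpha_simps)

lemma prod_list_twisted_conj:
  assumes "\<forall>u\<in>set us. norm u = 1" "sorted_wrt orthogonal us"
  shows "alpha (prod_list (map vect us)) * vect v * conj (prod_list (map vect us)) =
    vect (v - (\<Sum>u\<leftarrow>us. (2 * (u \<bullet> v)) *\<^sub>R u))"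
  using assms
proof (induction us)
  case (Cons u us)
  let ?x = "prod_list (map vect us)" and ?s = "\<Sum>u\<leftarrow>us. (2 * (u \<bullet> v)) *\<^sub>R u"
  have "alpha (vect u * ?x) * vect v * conj (vect u * ?x) = vect u * (alpha ?x * vect v * conj ?x) * vect u"
    by (simp add: alpha_times conj_times alpha_simps conj_vect mult.assoc)
  also have "\<dots> = vect (v - ?s - (2 * (u \<bullet> (v - ?s))) *\<^sub>R u)"
    using Cons by (simp add: vect_sandwich)
  finally have "alpha (vect u * ?x) * vect v * conj (vect u * ?x) =
    vect (v - ?s - (2 * (u \<bullet> (v - ?s))) *\<^sub>R u)" .
  \<comment> \<open>The sum is a combination of vectors orthogonal to \<open>u\<close>, so the
    reflection in \<open>u\<close> subtracts the same multiple of \<open>u\<close> as it would from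
    \<open>v\<close>.\<close>
  moreover have "u \<bullet> ?s = 0"
    using Cons(3) by (induction us) (auto simp: inner_add_right orthogonal_def)
  ultimately show ?case by (simp add: inner_diff_right algebra_simps)
qed (simp add: alpha_simps conj_one)

text \<open>The vector v - T v lies in the -1-eigenspace because T is an involution, and its
  coefficient along a basis vector b is 2 (b \<bullet> v) because T is orthogonal and T b = -b. Each
  unit vector lowers the trace by 2.\<close>

lemma orthogonal_involution_eq_reflections:
  fixes T :: "real^'d^'d"
  assumes T: "orthogonal_matrix T" and TT: "T ** T = mat 1"
  obtains us where "\<forall>u\<in>set us. norm u = 1" "sorted_wrt orthogonal us"
    "\<And>v. T *v v = v - (\<Sum>u\<leftarrow>us. (2 * (u \<bullet> v)) *\<^sub>R u)"
    "trace T = real CARD('d) - 2 * real (length us)"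
proof -
  let ?W = "{v. T *v v = - v}"
  have "subspace ?W"
    by (auto simp: subspace_def matrix_vector_right_distrib matrix_vector_mult_scaleR)
  then obtain B where B: "B \<subseteq> ?W" "pairwise orthogonal B" "\<And>x. x \<in> B \<Longrightarrow> norm x = 1"
    "independent B" "span B = ?W"
    by (rule orthonormal_basis_subspace) metis
  have fin: "finite B" using B(4) by (rule independent_imp_finite)
  obtain us where us: "set us = B" "distinct us" using finite_distinct_list[OF fin] by blast
  have sum_us: "(\<Sum>u\<leftarrow>us. f u) = (\<Sum>u\<in>B. f u)" for f :: "_ \<Rightarrow> 'z::comm_monoid_add"
    using us by (simp add: sum_list_distinct_conv_sum_set)
  have inner_T: "(T *v v) \<bullet> (T *v w) = v \<bullet> w" for v w
    using T orthogonal_transformation_matrix[of "(*v) T"] by (auto simp: orthogonal_transformation_def)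
  have Tv: "T *v v = v - (\<Sum>u\<in>B. (2 * (u \<bullet> v)) *\<^sub>R u)" for v
  proof -
    have "T *v (v - T *v v) = - (v - T *v v)"
      by (simp add: matrix_vector_mult_diff_distrib matrix_vector_mul_assoc TT)
    then have w: "v - T *v v \<in> span B" using B by simp
    have "b \<bullet> (v - T *v v) = 2 * (b \<bullet> v)" if "b \<in> B" for b
    proof -
      have "- b \<bullet> (T *v v) = b \<bullet> v" using inner_T[of b v] that B(1) by auto
      then show ?thesis by (simp add: inner_diff_right)
    qed
    then have "(\<Sum>b\<in>B. (2 * (b \<bullet> v)) *\<^sub>R b) = (\<Sum>b\<in>B. (b \<bullet> (v - T *v v)) *\<^sub>R b)"
      by (intro sum.cong) auto
    also have "\<dots> = v - T *v v"
      using orthonormal_basis_expand[OF B(2,3) w fin] by (simp add: inner_commute)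
    finally show ?thesis by simp
  qed
  show ?thesis
  proof (rule that[of us])
    show "\<forall>u\<in>set us. norm u = 1" using us B by auto
    show "sorted_wrt orthogonal us"
      using us(2) B(2) unfolding us(1)[symmetric]
      by (induction us) (auto simp: pairwise_insert)
    show "T *v v = v - (\<Sum>u\<leftarrow>us. (2 * (u \<bullet> v)) *\<^sub>R u)" for v
      unfolding sum_us by (rule Tv)
    have Tii: "T $ i $ i = 1 - (\<Sum>u\<in>B. 2 * (u $ i * u $ i))" for i
    proof -
      have "T $ i $ i = (T *v axis i 1) $ i"
        by (simp add: matrix_vector_mul_component inner_axis)
      then show ?thesis by (simp add: Tv inner_axis mult.assoc)
    qed
    have "trace T = real CARD('d) - (\<Sum>i\<in>UNIV. \<Sum>u\<in>B. 2 * (u $ i * u $ i))"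
      by (simp add: trace_def Tii sum_subtractf)
    also have "(\<Sum>i\<in>UNIV. \<Sum>u\<in>B. 2 * (u $ i * u $ i)) = (\<Sum>u\<in>B. 2 * (u \<bullet> u))"
      by (subst sum.swap) (simp add: inner_vec_def sum_distrib_left)
    also have "\<dots> = (\<Sum>u\<in>B. 2)"
      using B(3) by (intro sum.cong) (auto simp: power2_norm_eq_inner[symmetric])
    also have "\<dots> = 2 * real (length us)"
      using us by (simp add: distinct_card[symmetric])
    finally show "trace T = real CARD('d) - 2 * real (length us)" .
  qed
qed

text \<open>Square and parity agree for x and -x, so computing them for one product of basis vectors
  settles every lift.\<close>

lemma involution_lift:
  fixes T :: "((real, 'd::{finite,linorder}) vec, 'd) vec"
  assumes "orthogonal_matrix T" "T ** T = mat 1"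
  obtains k x where "trace T = real CARD('d) - 2 * real k" "x \<in> PIN" "rho (coeff x) = T"
    "\<And>y. y \<in> PIN \<Longrightarrow> rho (coeff y) = T \<Longrightarrow> y * y = (-1) ^ (k * (k + 1) div 2) \<and> alpha y = (-1) ^ k * y"
proof -
  obtain us where us: "\<forall>u\<in>set us. norm u = 1" "sorted_wrt orthogonal us"
    "\<And>v. T *v v = v - (\<Sum>u\<leftarrow>us. (2 * (u \<bullet> v)) *\<^sub>R u)"
    "trace T = real CARD('d) - 2 * real (length us)"
    using orthogonal_involution_eq_reflections[OF assms] by blast
  define x where "x = prod_list (map vect us)"
  have xP: "x \<in> PIN" unfolding x_def by (rule prod_list_PIN[OF us(1)])
  have xT: "rho (coeff x) = T"
    by (rule rho_eqI[OF xP]) (simp only: x_def us(3) prod_list_twisted_conj[OF us(1,2)])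
  have xx: "x * x = (-1) ^ (length us * (length us + 1) div 2)" "alpha x = (-1) ^ length us * x"
    unfolding x_def by (rule prod_list_square[OF us(1,2)], rule alpha_prod_list)
  show ?thesis
  proof (rule that[OF us(4) xP xT])
    fix y :: "'d clifford" assume "y \<in> PIN" "rho (coeff y) = T"
    then have "y = x \<or> y = - x" using rho_eq_imp[of y x] xP xT by simp
    then show "y * y = (-1) ^ (length us * (length us + 1) div 2) \<and> alpha y = (-1) ^ length us * y"
    proof
      assume "y = x"
      then show ?thesis by (simp only: xx)
    next
      assume "y = - x"
      then show ?thesis by (simp only: alpha_simps xx mult_minus_left mult_minus_right minus_minus simp_thms)
    qed
  qed
qed

section \<open>The Coxeter presentation of the symmetric group\<close>

lemma Sym_id [simp]: "id \<in> Sym n"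
  by (simp add: Sym_def permutes_id)

lemma Sym_comp: "p \<in> Sym n \<Longrightarrow> q \<in> Sym n \<Longrightarrow> p \<circ> q \<in> Sym n"
  by (simp add: Sym_def permutes_compose)

lemma s_gen_Sym: "1 \<le> i \<Longrightarrow> i < n \<Longrightarrow> s_gen i \<in> Sym n"
  by (simp add: Sym_def s_gen_def permutes_swap_id)

lemma s_gen_apply: "s_gen i x = (if x = i then i + 1 else if x = i + 1 then i else x)"
  by (simp add: s_gen_def transpose_def)

lemma s_gen_square: "s_gen i \<circ> s_gen i = id"
  by (simp add: s_gen_def)

lemma s_gen_pair_square: "Suc i < j \<Longrightarrow> (s_gen i \<circ> s_gen j) \<circ> (s_gen i \<circ> s_gen j) = id"
  by (auto simp: fun_eq_iff s_gen_apply)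

lemma s_gen_braid: "s_gen i \<circ> s_gen (i + 1) \<circ> s_gen i = s_gen (i + 1) \<circ> s_gen i \<circ> s_gen (i + 1)"
  by (auto simp: fun_eq_iff s_gen_apply)

text \<open>\<open>insert_cycle n k = s_k \<circ> \<dots> \<circ> s_n\<close>; these are representatives of the left cosets of
  \<open>Sym n\<close> in \<open>Sym (n + 1)\<close>, indexed by the image \<open>k\<close> of \<open>n + 1\<close>.\<close>

definition insert_cycle :: "nat \<Rightarrow> nat \<Rightarrow> nat \<Rightarrow> nat" where
  "insert_cycle n k x = (if x = Suc n then k else if k \<le> x \<and> x \<le> n then Suc x else x)"

lemma insert_cycle_top: "insert_cycle n (Suc n) = id"
  by (auto simp: insert_cycle_def fun_eq_iff)

lemma insert_cycle_step: "k \<le> n \<Longrightarrow> insert_cycle n k = s_gen k \<circ> insert_cycle n (Suc k)"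
  by (auto simp: insert_cycle_def fun_eq_iff s_gen_apply)

lemma insert_cycle_Sym: "1 \<le> k \<Longrightarrow> k \<le> Suc n \<Longrightarrow> insert_cycle n k \<in> Sym (Suc n)"
proof -
  assume k: "1 \<le> k" and "k \<le> Suc n"
  show ?thesis
    using \<open>k \<le> Suc n\<close>
  proof (induction rule: inc_induct)
    case (step m)
    have "s_gen m \<circ> insert_cycle n (Suc m) \<in> Sym (Suc n)"
      using step k by (intro Sym_comp s_gen_Sym) linarith+
    then show ?case
      using step by (simp only: insert_cycle_step less_Suc_eq_le)
  qed (simp only: insert_cycle_top Sym_id)
qed

lemma Sym_Suc_decompose:
  assumes g: "g \<in> Sym (Suc n)"
  obtains "1 \<le> g (Suc n)" "g (Suc n) \<le> Suc n"
    "inv (insert_cycle n (g (Suc n))) \<circ> g \<in> Sym n"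
    "insert_cycle n (g (Suc n)) \<circ> (inv (insert_cycle n (g (Suc n))) \<circ> g) = g"
proof -
  let ?k = "g (Suc n)" and ?D = "insert_cycle n (g (Suc n))"
  have "?k \<in> {1..Suc n}" using g permutes_in_image[of g "{1..Suc n}" "Suc n"] by (simp add: Sym_def)
  then have k: "1 \<le> ?k" "?k \<le> Suc n" by auto
  then have D: "?D permutes {1..Suc n}" using insert_cycle_Sym[of ?k n] by (simp add: Sym_def)
  have "inv ?D \<circ> g permutes {1..Suc n}"
    using g D by (intro permutes_compose permutes_inv) (auto simp: Sym_def)
  moreover have "(inv ?D \<circ> g) (Suc n) = Suc n"
    using D by (auto simp: permutes_inv_eq insert_cycle_def)
  ultimately have "inv ?D \<circ> g permutes {1..n}"
    by (elim permutes_superset) (auto simp: le_Suc_eq)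
  moreover have "?D \<circ> (inv ?D \<circ> g) = g"
    using permutes_inv_o(1)[OF D] by (simp add: comp_assoc[symmetric])
  ultimately show thesis using k that by (simp add: Sym_def)
qed

text \<open>The factor in the smaller symmetric group is reached by the induction hypothesis; the
  coset representative is then prefixed one generator at a time, from the trivial one
  downwards.\<close>

lemma Sym_induct [consumes 1, case_names id step]:
  assumes "g \<in> Sym n" "P id"
    "\<And>i g. 1 \<le> i \<Longrightarrow> i < n \<Longrightarrow> g \<in> Sym n \<Longrightarrow> P g \<Longrightarrow> P (s_gen i \<circ> g)"
  shows "P g"
  using assms
proof (induction n arbitrary: g P)
  case 0
  then show ?case by (simp add: Sym_def permutes_empty)
next
  case (Suc n)
  let ?D = "insert_cycle n"
  have sub: "h \<in> Sym (Suc n)" if "h \<in> Sym n" for h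
    using that unfolding Sym_def by (auto elim: permutes_subset)
  obtain k h where k: "1 \<le> k" "k \<le> Suc n" and h: "h \<in> Sym n" and g: "g = ?D k \<circ> h"
    using Sym_Suc_decompose[OF Suc.prems(1)] by metis
  have "P h"
  proof (rule Suc.IH[OF h])
    show "P id" by (rule Suc.prems)
    show "P (s_gen i \<circ> g)" if "1 \<le> i" "i < n" "g \<in> Sym n" "P g" for i g
      using that(2) by (intro Suc.prems(3) that sub) linarith
  qed
  have "P (?D k \<circ> h)"
    using k(2,1)
  proof (induction rule: inc_induct)
    case base
    then show ?case using \<open>P h\<close> by (simp only: insert_cycle_top id_comp)
  next
    case (step m)
    have "P (s_gen m \<circ> (?D (Suc m) \<circ> h))"
    proof (rule Suc.prems(3))
      show "?D (Suc m) \<circ> h \<in> Sym (Suc n)"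
        using step by (intro Sym_comp insert_cycle_Sym sub h) linarith+
    qed (use step in linarith | rule step.IH)+
    then show ?case using step by (simp only: insert_cycle_step comp_assoc less_Suc_eq_le)
  qed
  then show ?case by (simp only: g)
qed

text \<open>When k is neither i nor i + 1, the generator s_i fixes the coset with index k. It then
  reappears on the right as a generator of \<open>Sym n\<close>, with its index kept if it is below
  k and lowered by one if it is above.\<close>

lemma s_gen_insert_cycle_low:
  "i + 1 < k \<Longrightarrow> k \<le> Suc n \<Longrightarrow> s_gen i \<circ> insert_cycle n k = insert_cycle n k \<circ> s_gen i"
  by (auto simp: fun_eq_iff s_gen_apply insert_cycle_def)

lemma s_gen_insert_cycle_high:
  "k \<le> i \<Longrightarrow> i < n \<Longrightarrow> s_gen (Suc i) \<circ> insert_cycle n k = insert_cycle n k \<circ> s_gen i"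
  by (auto simp: fun_eq_iff s_gen_apply insert_cycle_def)

text \<open>The value that the homomorphism under construction must take on
  \<open>insert_cycle n k\<close>.\<close>

definition cycle_word :: "(nat \<Rightarrow> 'm::monoid_mult) \<Rightarrow> nat \<Rightarrow> nat \<Rightarrow> 'm" where
  "cycle_word c n k = prod_list (map c [k..<Suc n])"

lemma cycle_word_step: "k \<le> n \<Longrightarrow> cycle_word c n k = c k * cycle_word c n (Suc k)"
  by (simp add: cycle_word_def upt_conv_Cons del: upt_Suc)

lemma cycle_word_top: "cycle_word c n (Suc n) = 1"
  by (simp add: cycle_word_def)

text \<open>A monoid as target lets the Clifford algebra itself be used; \<open>square\<close> makes
  the generators invertible.\<close>

locale coxeter_relations =
  fixes c :: "nat \<Rightarrow> 'm::monoid_mult" and N :: nat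
  assumes square: "1 \<le> i \<Longrightarrow> i < N \<Longrightarrow> c i * c i = 1"
    and braid: "1 \<le> i \<Longrightarrow> Suc i < N \<Longrightarrow> c i * c (Suc i) * c i = c (Suc i) * c i * c (Suc i)"
    and far: "1 \<le> i \<Longrightarrow> Suc i < j \<Longrightarrow> j < N \<Longrightarrow> c i * c j = c j * c i"
begin

lemma cycle_word_commute_step:
  assumes "m \<le> n" "d * c m = c m * d" "d * cycle_word c n (Suc m) = cycle_word c n (Suc m) * e"
  shows "d * cycle_word c n m = cycle_word c n m * e"
proof -
  have "d * (c m * w) = c m * w * e" if "d * w = w * e" for w
  proof -
    have "d * (c m * w) = c m * (d * w)" by (simp only: mult.assoc[symmetric] assms(2))
    then show ?thesis by (simp only: that mult.assoc)
  qed
  then show ?thesis using assms by (simp only: cycle_word_step)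
qed

lemma cycle_word_low:
  assumes "1 \<le> i" "i + 1 < k" "k \<le> Suc n" "n < N"
  shows "c i * cycle_word c n k = cycle_word c n k * c i"
  using assms(3,2)
proof (induction rule: inc_induct)
  case (step m)
  show ?case
  proof (rule cycle_word_commute_step)
    show "c i * c m = c m * c i" using step assms by (intro far) auto
  qed (use step in auto)
qed (simp add: cycle_word_top)

text \<open>The braid relation is used once, at k = i. Generators of index below i commute with
  \<open>c (Suc i)\<close> by \<open>far\<close>.\<close>

lemma cycle_word_high:
  assumes "1 \<le> k" "k \<le> i" "i < n" "n < N"
  shows "c (Suc i) * cycle_word c n k = cycle_word c n k * c i"
  using assms(2,1)
proof (induction rule: inc_induct)
  case base
  let ?w = "cycle_word c n (Suc (Suc i))"
  have "c (Suc i) * cycle_word c n i = c (Suc i) * c i * c (Suc i) * ?w"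
    using assms by (simp add: cycle_word_step mult.assoc)
  also have "c (Suc i) * c i * c (Suc i) = c i * c (Suc i) * c i"
    using assms base by (intro braid[symmetric]) linarith+
  also have "c i * c (Suc i) * c i * ?w = c i * c (Suc i) * (c i * ?w)"
    by (rule mult.assoc)
  also have "c i * ?w = ?w * c i"
    using assms base by (intro cycle_word_low) auto
  also have "c i * c (Suc i) * (?w * c i) = cycle_word c n i * c i"
    using assms by (simp add: cycle_word_step mult.assoc)
  finally show ?case .
next
  case (step m)
  show ?case
  proof (rule cycle_word_commute_step)
    show "c (Suc i) * c m = c m * c (Suc i)" using step assms by (intro far[symmetric]) auto
  qed (use step assms in auto)
qed

text \<open>Compatibility with left multiplication by generators is what the coset recursion
  delivers; induction on the left factor turns it into multiplicativity afterwards.\<close>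

lemma exists_extension:
  "n \<le> N \<Longrightarrow> \<exists>F. F id = 1 \<and> (\<forall>i g. 1 \<le> i \<longrightarrow> i < n \<longrightarrow> g \<in> Sym n \<longrightarrow> F (s_gen i \<circ> g) = c i * F g)"
proof (induction n)
  case 0
  show ?case by (intro exI[of _ "\<lambda>_. 1"]) auto
next
  case (Suc n)
  then obtain F where F1: "F id = 1"
    and F: "\<And>i g. 1 \<le> i \<Longrightarrow> i < n \<Longrightarrow> g \<in> Sym n \<Longrightarrow> F (s_gen i \<circ> g) = c i * F g"
    by (metis Suc_leD)
  let ?D = "insert_cycle n" and ?w = "cycle_word c n"
  define F' where "F' g = ?w (g (Suc n)) * F (inv (?D (g (Suc n))) \<circ> g)" for g
  have F'_eq: "F' (?D k \<circ> h) = ?w k * F h" if "1 \<le> k" "k \<le> Suc n" "h \<in> Sym n" for k h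
  proof -
    have h: "h (Suc n) = Suc n" using that by (auto simp: Sym_def permutes_not_in)
    have "?D k permutes {1..Suc n}" using insert_cycle_Sym[of k n] that by (simp add: Sym_def)
    then have "inv (?D k) \<circ> (?D k \<circ> h) = h"
      by (simp only: comp_assoc[symmetric] permutes_inv_o(2) id_comp)
    moreover have "(?D k \<circ> h) (Suc n) = k" by (simp add: h insert_cycle_def)
    ultimately show ?thesis by (simp only: F'_def)
  qed
  have "F' id = 1"
    using F'_eq[of "Suc n" id] by (simp add: insert_cycle_top cycle_word_top F1)
  moreover have "F' (s_gen i \<circ> g) = c i * F' g" if i: "1 \<le> i" "i < Suc n" and g: "g \<in> Sym (Suc n)" for i g
  proof -
    obtain k h where k: "1 \<le> k" "k \<le> Suc n" and h: "h \<in> Sym n" and gk: "g = ?D k \<circ> h"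
      using Sym_Suc_decompose[OF g] by metis
    have Fg: "F' g = ?w k * F h" unfolding gk by (rule F'_eq[OF k h])
    \<comment> \<open>The coset of \<open>g\<close> has index k. If k is i or i + 1, then s_i
      exchanges these two cosets, and the recursion for the word, with \<open>square\<close> when k
      = i, gives the claim. Otherwise the coset stays and a generator passes to \<open>h\<close>, by
      \<open>cycle_word_low\<close> or \<open>cycle_word_high\<close>.\<close>
    consider "i + 1 < k" | "k = Suc i" | "k = i" | j where "i = Suc j" "k \<le> j"
      by (cases i) (linarith | force simp: le_less_linear)+
    then show ?thesis
    proof cases
      case 1
      have "F' (s_gen i \<circ> g) = F' (?D k \<circ> (s_gen i \<circ> h))"
        unfolding gk comp_assoc[symmetric] using s_gen_insert_cycle_low[OF 1 k(2)] by simp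
      also have "\<dots> = ?w k * F (s_gen i \<circ> h)"
        using 1 k i h by (intro F'_eq Sym_comp s_gen_Sym) auto
      also have "\<dots> = (?w k * c i) * F h"
        using 1 k i h by (subst F) (auto simp: mult.assoc)
      also have "?w k * c i = c i * ?w k"
        using 1 k i Suc.prems by (intro cycle_word_low[symmetric]) auto
      finally show ?thesis by (simp only: Fg mult.assoc)
    next
      case 2
      have "F' (s_gen i \<circ> g) = F' (?D i \<circ> h)"
        using 2 k by (simp only: gk insert_cycle_step[of i n] comp_assoc)
      also have "\<dots> = ?w i * F h" using i h by (intro F'_eq) auto
      also have "\<dots> = c i * F' g" using 2 k by (simp add: Fg cycle_word_step mult.assoc)
      finally show ?thesis .
    next
      case 3
      have "s_gen i \<circ> g = s_gen i \<circ> s_gen i \<circ> (?D (Suc i) \<circ> h)"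
        using 3 i by (simp only: gk insert_cycle_step[of i n] comp_assoc less_Suc_eq_le)
      then have "F' (s_gen i \<circ> g) = ?w (Suc i) * F h"
        using i h by (simp only: s_gen_square id_comp) (intro F'_eq, auto)
      also have "\<dots> = c i * c i * (?w (Suc i) * F h)"
        using square[of i] i Suc.prems by simp
      also have "\<dots> = c i * F' g" using 3 i by (simp add: Fg cycle_word_step mult.assoc)
      finally show ?thesis .
    next
      case 4
      then have j: "j < n" "k \<le> j" using i by auto
      have "F' (s_gen i \<circ> g) = F' (?D k \<circ> (s_gen j \<circ> h))"
        unfolding gk comp_assoc[symmetric] using s_gen_insert_cycle_high[OF j(2,1)] 4 by simp
      also have "\<dots> = ?w k * F (s_gen j \<circ> h)"
        using j k h by (intro F'_eq Sym_comp s_gen_Sym) auto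
      also have "\<dots> = (?w k * c j) * F h"
        using j k h by (subst F) (auto simp: mult.assoc)
      also have "?w k * c j = c i * ?w k"
        using j k 4 Suc.prems by (simp add: cycle_word_high)
      finally show ?thesis by (simp only: Fg mult.assoc)
    qed
  qed
  ultimately show ?case by blast
qed

lemma exists_homomorphism:
  obtains F where "F id = 1" "\<And>i g. 1 \<le> i \<Longrightarrow> i < N \<Longrightarrow> g \<in> Sym N \<Longrightarrow> F (s_gen i \<circ> g) = c i * F g"
    "\<And>g h. g \<in> Sym N \<Longrightarrow> h \<in> Sym N \<Longrightarrow> F (g \<circ> h) = F g * F h"
proof -
  obtain F where F: "F id = 1" "\<And>i g. 1 \<le> i \<Longrightarrow> i < N \<Longrightarrow> g \<in> Sym N \<Longrightarrow> F (s_gen i \<circ> g) = c i * F g"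
    using exists_extension[of N] by auto
  have "F (g \<circ> h) = F g * F h" if "g \<in> Sym N" "h \<in> Sym N" for g h
    using that(1)
  proof (induction rule: Sym_induct)
    case id
    show ?case by (simp only: F(1) id_comp mult_1_left)
  next
    case (step i g)
    then have "F (s_gen i \<circ> (g \<circ> h)) = c i * F (g \<circ> h)"
      using that(2) by (intro F(2) Sym_comp) auto
    then show ?case
      using step by (simp only: comp_assoc F(2) mult.assoc)
  qed
  then show thesis using that F by blast
qed

end

section \<open>Conjugacy of products of adjacent transpositions\<close>

text \<open>To correct p at a new point a, transpose p a and f a. Neither is a value of f on A, by
  injectivity of p and of f, so the earlier values survive.\<close>

lemma partial_injection_extends:
  assumes "finite A" "inj_on f A" "A \<subseteq> S" "f ` A \<subseteq> S"
  shows "\<exists>p. p permutes S \<and> (\<forall>x\<in>A. p x = f x)"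
  using assms
proof (induction A rule: finite_induct)
  case empty
  show ?case using permutes_id by blast
next
  case (insert a A)
  then obtain p where p: "p permutes S" "\<forall>x\<in>A. p x = f x" by auto
  let ?q = "Transposition.transpose (p a) (f a) \<circ> p"
  have "?q permutes S"
    using p insert by (intro permutes_compose permutes_swap_id) (auto simp: permutes_in_image)
  moreover have "?q x = f x" if "x \<in> insert a A" for x
  proof (cases "x = a")
    case False
    then have "x \<in> A" using that by simp
    then have "p x = f x" "f x \<noteq> f a" "p x \<noteq> p a"
      using p insert False by (auto simp: inj_on_def permutes_inj[THEN inj_eq])
    then show ?thesis by (simp add: Transposition.transpose_def)
  qed simp
  ultimately show ?case by blast
qed

lemma comp_transpose: "inj p \<Longrightarrow>
  p \<circ> Transposition.transpose a b = Transposition.transpose (p a) (p b) \<circ> p"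
  by (auto simp: fun_eq_iff Transposition.transpose_def inj_eq)

text \<open>The permutation carries 1, 2, 3, 4 to i, i + 1, j, j + 1, which are distinct because i +
  1 < j. This conjugacy lets the character at one element control all commuting pairs of distinct
  generators.\<close>

lemma s_gen_pair_conjugate:
  assumes "4 \<le> n" "1 \<le> i" "Suc i < j" "j < n"
  obtains p where "p \<in> Sym n" "p \<circ> s_gen 1 = s_gen i \<circ> p"
    "p \<circ> (s_gen 1 \<circ> s_gen 3) = s_gen i \<circ> s_gen j \<circ> p"
proof -
  define f where "f x = (if x = 1 then i else if x = 2 then Suc i else if x = 3 then j else Suc j)" for x :: nat
  have "\<exists>p. p permutes {1..n} \<and> (\<forall>x\<in>{1,2,3,4}. p x = f x)"
    using assms by (intro partial_injection_extends) (auto simp: f_def inj_on_def)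
  then obtain p where p: "p permutes {1..n}" and pf: "\<forall>x\<in>{1,2,3,4}. p x = f x" by blast
  \<comment> \<open>Unfolding \<open>s_gen\<close> produces the points 1 + 1 and 3 + 1, so the
    values of \<open>p\<close> are stated in that form.\<close>
  have "(1::nat) + 1 = 2" "(3::nat) + 1 = 4" by simp_all
  then have pi: "p 1 = i" "p (1 + 1) = i + 1" "p 3 = j" "p (3 + 1) = j + 1"
    using pf by (simp_all only:) (simp_all add: f_def)
  have 1: "p \<circ> s_gen 1 = s_gen i \<circ> p" and 3: "p \<circ> s_gen 3 = s_gen j \<circ> p"
    by (simp_all only: s_gen_def comp_transpose[OF permutes_inj[OF p]] pi)
  then have "p \<circ> (s_gen 1 \<circ> s_gen 3) = s_gen i \<circ> s_gen j \<circ> p"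
    by (metis comp_assoc)
  with p 1 show thesis using that by (simp add: Sym_def)
qed

lemma s_gen_conjugate:
  assumes "2 \<le> n" "1 \<le> i" "i < n"
  obtains p where "p \<in> Sym n" "p \<circ> s_gen 1 = s_gen i \<circ> p"
proof -
  define f where "f x = (if x = 1 then i else Suc i)" for x :: nat
  have "\<exists>p. p permutes {1..n} \<and> (\<forall>x\<in>{1,2}. p x = f x)"
    using assms by (intro partial_injection_extends) (auto simp: f_def inj_on_def)
  then obtain p where p: "p permutes {1..n}" and pf: "\<forall>x\<in>{1,2}. p x = f x" by blast
  have "(1::nat) + 1 = 2" by simp
  then have pi: "p 1 = i" "p (1 + 1) = i + 1"
    using pf by (simp_all only:) (simp_all add: f_def)
  have "p \<circ> s_gen 1 = s_gen i \<circ> p"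
    by (simp only: s_gen_def comp_transpose[OF permutes_inj[OF p]] pi)
  with p show thesis using that by (simp add: Sym_def)
qed

section \<open>Lifts of a representation of the symmetric group\<close>

definition clifford_lift ::
    "nat \<Rightarrow> ((nat \<Rightarrow> nat) \<Rightarrow> ((real, 'd::{finite,linorder}) vec, 'd) vec) \<Rightarrow> ((nat \<Rightarrow> nat) \<Rightarrow> 'd clifford) \<Rightarrow> bool"
  where
  "clifford_lift n \<pi> F \<longleftrightarrow>
     (\<forall>g\<in>Sym n. F g \<in> PIN) \<and>
     (\<forall>g\<in>Sym n. \<forall>h\<in>Sym n. F (g \<circ> h) = F g * F h) \<and>
     (\<forall>g\<in>Sym n. rho (coeff (F g)) = \<pi> g)"

lemma is_lift_coeff: "is_lift n \<pi> (\<lambda>g. coeff (F g)) \<longleftrightarrow> clifford_lift n \<pi> F"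
proof -
  have "coeff x \<in> Pin \<longleftrightarrow> x \<in> PIN" for x :: "'a clifford"
    by (auto simp: Pin_eq coeff_inject)
  then show ?thesis
    by (simp add: is_lift_def clifford_lift_def coeff_mult[symmetric] coeff_inject)
qed

lemma is_lift_iff: "is_lift n \<pi> f \<longleftrightarrow> clifford_lift n \<pi> (\<lambda>g. Clifford (f g))"
  using is_lift_coeff[of n \<pi> "\<lambda>g. Clifford (f g)"] by (simp add: Clifford_inverse)

lemma spinorial_iff: "spinorial n \<pi> \<longleftrightarrow> (\<exists>F. clifford_lift n \<pi> F)"
  unfolding spinorial_def using is_lift_coeff is_lift_iff by blast

section \<open>Arithmetic of the residues\<close>

lemma even_triangular_iff: "even (k * (k + 1) div 2) \<longleftrightarrow> k mod 4 = 0 \<or> k mod 4 = 3" for k :: nat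
proof -
  have "\<exists>q. k = 4 * q \<or> k = 4 * q + 1 \<or> k = 4 * q + 2 \<or> k = 4 * q + 3" by presburger
  then consider q where "k = 4 * q" | q where "k = 4 * q + 1"
    | q where "k = 4 * q + 2" | q where "k = 4 * q + 3" by blast
  then show ?thesis
  proof cases
    case (1 q)
    have "k * (k + 1) = 2 * (2 * (q * (4 * q + 1)))" unfolding 1 by (simp add: algebra_simps)
    then have "k * (k + 1) div 2 = 2 * (q * (4 * q + 1))" by simp
    then have "even (k * (k + 1) div 2)" by (simp only: dvd_triv_left)
    moreover have "k mod 4 = 0" unfolding 1 by simp
    ultimately show ?thesis by blast
  next
    case (2 q)
    have "k * (k + 1) = 2 * ((4 * q + 1) * (2 * q + 1))" unfolding 2 by (simp add: algebra_simps)
    then have "k * (k + 1) div 2 = (4 * q + 1) * (2 * q + 1)" by simp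
    then have "odd (k * (k + 1) div 2)" by (simp only: even_mult_iff) simp
    moreover have "k mod 4 = 1" unfolding 2 by presburger
    ultimately show ?thesis by simp
  next
    case (3 q)
    have "k * (k + 1) = 2 * ((2 * q + 1) * (4 * q + 3))" unfolding 3 by (simp add: algebra_simps)
    then have "k * (k + 1) div 2 = (2 * q + 1) * (4 * q + 3)" by simp
    then have "odd (k * (k + 1) div 2)" by (simp only: even_mult_iff) simp
    moreover have "k mod 4 = 2" unfolding 3 by presburger
    ultimately show ?thesis by simp
  next
    case (4 q)
    have "k * (k + 1) = 2 * (2 * ((4 * q + 3) * (q + 1)))" unfolding 4 by (simp add: algebra_simps)
    then have "k * (k + 1) div 2 = 2 * ((4 * q + 3) * (q + 1))" by simp
    then have "even (k * (k + 1) div 2)" by (simp only: dvd_triv_left)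
    moreover have "k mod 4 = 3" unfolding 4 by presburger
    ultimately show ?thesis by blast
  qed
qed

lemma minus_one_power_eq_one_iff: "(-1) ^ m = (1 :: 'd::{finite,linorder} clifford) \<longleftrightarrow> even m"
proof -
  have "- 1 \<noteq> (1 :: 'd clifford)"
    by (rule PIN_neq_uminus[OF PIN.one, symmetric])
  then show ?thesis by (cases "even m") simp_all
qed

lemma real_cong_of_int: "real_cong (of_int x) a m \<longleftrightarrow> x mod m = a mod m"
proof -
  have "real_cong (of_int x) a m \<longleftrightarrow> (\<exists>k. x = a + m * k)"
    unfolding real_cong_def of_int_add[symmetric] of_int_mult[symmetric] of_int_eq_iff ..
  also have "\<dots> \<longleftrightarrow> m dvd x - a"
    by (auto simp: dvd_def algebra_simps)
  finally show ?thesis by (simp add: mod_eq_dvd_iff)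
qed

lemma real_cong_double: "real_cong (2 * x) (2 * a) (2 * m) \<longleftrightarrow> real_cong x a m"
proof -
  have "2 * x = of_int (2 * a) + of_int (2 * m) * of_int k \<longleftrightarrow> x = of_int a + of_int m * of_int k" for k
    by (auto simp: algebra_simps)
  then show ?thesis unfolding real_cong_def by blast
qed

lemma real_cong_nat:
  "real_cong (real k) 0 4 \<longleftrightarrow> k mod 4 = 0" "real_cong (real k) 3 4 \<longleftrightarrow> k mod 4 = 3"
proof -
  have "int k mod 4 = 0 \<longleftrightarrow> k mod 4 = 0" "int k mod 4 = 3 \<longleftrightarrow> k mod 4 = 3" by presburger+
  then show "real_cong (real k) 0 4 \<longleftrightarrow> k mod 4 = 0" "real_cong (real k) 3 4 \<longleftrightarrow> k mod 4 = 3"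
    using real_cong_of_int[of "int k" 0 4] real_cong_of_int[of "int k" 3 4] by simp_all
qed

section \<open>Conjugacy invariance, existence and uniqueness of lifts\<close>

locale symmetric_group_rep =
  fixes n :: nat and \<pi> :: "(nat \<Rightarrow> nat) \<Rightarrow> ((real, 'd::{finite,linorder}) vec, 'd) vec"
  assumes n: "4 \<le> n" and rep: "orth_rep n \<pi>"
begin

lemma orthogonal_pi: "g \<in> Sym n \<Longrightarrow> orthogonal_matrix (\<pi> g)"
  using rep by (simp add: orth_rep_def)

lemma pi_comp: "g \<in> Sym n \<Longrightarrow> h \<in> Sym n \<Longrightarrow> \<pi> (g \<circ> h) = \<pi> g ** \<pi> h"
  using rep by (simp add: orth_rep_def)

text \<open>The matrix is idempotent by multiplicativity and invertible by orthogonality.\<close>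

lemma pi_id: "\<pi> id = mat 1"
proof -
  have T: "transpose (\<pi> id) ** \<pi> id = mat 1"
    using orthogonal_pi[OF Sym_id] by (simp only: orthogonal_matrix_def)
  have "\<pi> id ** \<pi> id = \<pi> id"
    using pi_comp[OF Sym_id Sym_id] by (simp only: id_comp)
  then have "transpose (\<pi> id) ** (\<pi> id ** \<pi> id) = transpose (\<pi> id) ** \<pi> id" by (simp only:)
  then show ?thesis by (simp only: matrix_mul_assoc T matrix_mul_lid)
qed

lemma character_id: "character \<pi> id = real CARD('d)"
  by (simp add: character_def pi_id trace_I)

lemma trace_conjugate:
  assumes "p \<in> Sym n" "a \<in> Sym n" "b \<in> Sym n" "p \<circ> a = b \<circ> p"
  shows "trace (\<pi> b) = trace (\<pi> a)"
proof -
  have p: "transpose (\<pi> p) ** \<pi> p = mat 1" "\<pi> p ** transpose (\<pi> p) = mat 1"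
    using orthogonal_pi[OF assms(1)] by (simp_all add: orthogonal_matrix_def)
  have "\<pi> p ** \<pi> a = \<pi> b ** \<pi> p"
    using assms by (simp only: pi_comp[symmetric])
  then have "transpose (\<pi> p) ** (\<pi> b ** \<pi> p) = transpose (\<pi> p) ** (\<pi> p ** \<pi> a)" by simp
  then have "\<pi> a = transpose (\<pi> p) ** (\<pi> b ** \<pi> p)" by (simp add: matrix_mul_assoc p)
  also have "trace \<dots> = trace ((\<pi> b ** \<pi> p) ** transpose (\<pi> p))" by (rule trace_mul_sym)
  also have "\<dots> = trace (\<pi> b)" by (simp add: matrix_mul_assoc[symmetric] p)
  finally show ?thesis ..
qed

text \<open>The multiplicity \<open>k\<close> of the eigenvalue \<open>-1\<close>, and with it the square and the parity of
  a lift, depends only on the conjugacy class of the involution.\<close>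

lemma conjugate_involutions_lift:
  assumes a: "a \<in> Sym n" "a \<circ> a = id"
  obtains k where "character \<pi> id - character \<pi> a = 2 * real k"
    "\<And>p b. p \<in> Sym n \<Longrightarrow> b \<in> Sym n \<Longrightarrow> b \<circ> b = id \<Longrightarrow> p \<circ> a = b \<circ> p \<Longrightarrow> \<exists>x\<in>PIN. rho (coeff x) = \<pi> b"
    "\<And>p b y. p \<in> Sym n \<Longrightarrow> b \<in> Sym n \<Longrightarrow> b \<circ> b = id \<Longrightarrow> p \<circ> a = b \<circ> p \<Longrightarrow>
       y \<in> PIN \<Longrightarrow> rho (coeff y) = \<pi> b \<Longrightarrow> y * y = (-1) ^ (k * (k + 1) div 2) \<and> alpha y = (-1) ^ k * y"
proof -
  have inv: "\<pi> b ** \<pi> b = mat 1" if "b \<in> Sym n" "b \<circ> b = id" for b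
    using pi_comp[OF that(1) that(1)] that(2) by (simp only: pi_id)
  obtain k x where k: "trace (\<pi> a) = real CARD('d) - 2 * real k"
    using involution_lift[OF orthogonal_pi[OF a(1)] inv[OF a]] by blast
  have *: "(\<exists>x\<in>PIN. rho (coeff x) = \<pi> b) \<and>
      (\<forall>y\<in>PIN. rho (coeff y) = \<pi> b \<longrightarrow> y * y = (-1) ^ (k * (k + 1) div 2) \<and> alpha y = (-1) ^ k * y)"
    if b: "p \<in> Sym n" "b \<in> Sym n" "b \<circ> b = id" "p \<circ> a = b \<circ> p" for p b
  proof -
    obtain k' x where x: "trace (\<pi> b) = real CARD('d) - 2 * real k'" "x \<in> PIN" "rho (coeff x) = \<pi> b"
      "\<And>y. y \<in> PIN \<Longrightarrow> rho (coeff y) = \<pi> b \<Longrightarrow> y * y = (-1) ^ (k' * (k' + 1) div 2) \<and> alpha y = (-1) ^ k' * y"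
      using involution_lift[OF orthogonal_pi[OF b(2)] inv[OF b(2,3)]] by blast
    have "k' = k" using k x(1) trace_conjugate[OF b(1) a(1) b(2,4)] by simp
    then show ?thesis using x(2-4) by blast
  qed
  show thesis
  proof (rule that[of k])
    show "character \<pi> id - character \<pi> a = 2 * real k"
      unfolding character_id by (simp add: character_def k)
  qed (use * in blast)+
qed

lemma s_gen_lift:
  obtains k where "character \<pi> id - character \<pi> (s_gen 1) = 2 * real k"
    "\<And>i. 1 \<le> i \<Longrightarrow> i < n \<Longrightarrow> \<exists>x\<in>PIN. rho (coeff x) = \<pi> (s_gen i)"
    "\<And>i y. 1 \<le> i \<Longrightarrow> i < n \<Longrightarrow> y \<in> PIN \<Longrightarrow> rho (coeff y) = \<pi> (s_gen i) \<Longrightarrow>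
      y * y = (-1) ^ (k * (k + 1) div 2) \<and> alpha y = (-1) ^ k * y"
proof -
  have 1: "s_gen 1 \<in> Sym n" using n by (intro s_gen_Sym) auto
  show thesis
  proof (rule conjugate_involutions_lift[OF 1 s_gen_square])
    fix k assume k: "character \<pi> id - character \<pi> (s_gen 1) = 2 * real k"
    "\<And>p b. p \<in> Sym n \<Longrightarrow> b \<in> Sym n \<Longrightarrow> b \<circ> b = id \<Longrightarrow> p \<circ> s_gen 1 = b \<circ> p \<Longrightarrow>
       \<exists>x\<in>PIN. rho (coeff x) = \<pi> b"
    "\<And>p b y. p \<in> Sym n \<Longrightarrow> b \<in> Sym n \<Longrightarrow> b \<circ> b = id \<Longrightarrow> p \<circ> s_gen 1 = b \<circ> p \<Longrightarrow>
       y \<in> PIN \<Longrightarrow> rho (coeff y) = \<pi> b \<Longrightarrow> y * y = (-1) ^ (k * (k + 1) div 2) \<and> alpha y = (-1) ^ k * y"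
    show thesis
    proof (rule that[OF k(1)])
      fix i assume i: "1 \<le> i" "i < n"
      obtain p where p: "p \<in> Sym n" "p \<circ> s_gen 1 = s_gen i \<circ> p"
        using s_gen_conjugate[of n i] n i by auto
      show "\<exists>x\<in>PIN. rho (coeff x) = \<pi> (s_gen i)"
        by (rule k(2)[OF p(1) s_gen_Sym[OF i] s_gen_square p(2)])
      show "y * y = (-1) ^ (k * (k + 1) div 2) \<and> alpha y = (-1) ^ k * y"
        if "y \<in> PIN" "rho (coeff y) = \<pi> (s_gen i)" for y
        by (rule k(3)[OF p(1) s_gen_Sym[OF i] s_gen_square p(2) that])
    qed
  qed
qed

text \<open>Existence is left out here because lifts of these products arise as products of lifts of
  the generators.\<close>

lemma s_gen_pair_lift:
  obtains k where "character \<pi> id - character \<pi> (s_gen 1 \<circ> s_gen 3) = 2 * real k"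
    "\<And>i j y. 1 \<le> i \<Longrightarrow> Suc i < j \<Longrightarrow> j < n \<Longrightarrow> y \<in> PIN \<Longrightarrow> rho (coeff y) = \<pi> (s_gen i \<circ> s_gen j) \<Longrightarrow>
      y * y = (-1) ^ (k * (k + 1) div 2) \<and> alpha y = (-1) ^ k * y"
proof -
  have 1: "s_gen 1 \<circ> s_gen 3 \<in> Sym n" using n by (intro Sym_comp s_gen_Sym) auto
  have 2: "(s_gen 1 \<circ> s_gen 3) \<circ> (s_gen 1 \<circ> s_gen 3) = id" by (rule s_gen_pair_square) simp
  show thesis
  proof (rule conjugate_involutions_lift[OF 1 2])
    fix k assume k: "character \<pi> id - character \<pi> (s_gen 1 \<circ> s_gen 3) = 2 * real k"
    "\<And>p b y. p \<in> Sym n \<Longrightarrow> b \<in> Sym n \<Longrightarrow> b \<circ> b = id \<Longrightarrow> p \<circ> (s_gen 1 \<circ> s_gen 3) = b \<circ> p \<Longrightarrow>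
       y \<in> PIN \<Longrightarrow> rho (coeff y) = \<pi> b \<Longrightarrow> y * y = (-1) ^ (k * (k + 1) div 2) \<and> alpha y = (-1) ^ k * y"
    show thesis
    proof (rule that[OF k(1)])
      fix i j y assume ij: "1 \<le> i" "Suc i < j" "j < n"
        and y: "y \<in> PIN" "rho (coeff y) = \<pi> (s_gen i \<circ> s_gen j)"
      obtain p where p: "p \<in> Sym n" "p \<circ> (s_gen 1 \<circ> s_gen 3) = s_gen i \<circ> s_gen j \<circ> p"
        using s_gen_pair_conjugate[OF n ij] by metis
      have "s_gen i \<circ> s_gen j \<in> Sym n" using ij by (intro Sym_comp s_gen_Sym) auto
      then show "y * y = (-1) ^ (k * (k + 1) div 2) \<and> alpha y = (-1) ^ k * y"
        by (rule k(2)[OF p(1) _ s_gen_pair_square[OF ij(2)] p(2) y])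
    qed
  qed
qed

lemma rho_triple:
  assumes "x \<in> PIN" "y \<in> PIN" "z \<in> PIN" "a \<in> Sym n" "b \<in> Sym n" "c \<in> Sym n"
    "rho (coeff x) = \<pi> a" "rho (coeff y) = \<pi> b" "rho (coeff z) = \<pi> c"
  shows "rho (coeff (x * y * z)) = \<pi> (a \<circ> b \<circ> c)"
  using assms by (simp only: rho_times PIN_times pi_comp Sym_comp)

text \<open>Lifts of consecutive generators satisfy the braid relation up to a sign, which is absorbed
  into the second one because the two sides have degrees 1 and 2 in it.\<close>

lemma exists_braided_lifts:
  assumes "\<And>i. 1 \<le> i \<Longrightarrow> i < n \<Longrightarrow> \<exists>x\<in>PIN. rho (coeff x) = \<pi> (s_gen i)"
  obtains c where "\<And>i. 1 \<le> i \<Longrightarrow> i < n \<Longrightarrow> c i \<in> PIN \<and> rho (coeff (c i)) = \<pi> (s_gen i)"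
    "\<And>i. 1 \<le> i \<Longrightarrow> Suc i < n \<Longrightarrow> c i * c (Suc i) * c i = c (Suc i) * c i * c (Suc i)"
proof -
  let ?P = "\<lambda>i x. 1 \<le> i \<and> i < n \<longrightarrow> x \<in> PIN \<and> rho (coeff x) = \<pi> (s_gen i)"
  let ?Q = "\<lambda>i x y :: 'd clifford. 1 \<le> i \<and> Suc i < n \<longrightarrow> x * y * x = y * x * y"
  \<comment> \<open>Braid relations link only neighbouring generators, so the signs can be fixed one
    after the other along a path. Index 0 is a vacuous start, and at index 1 any lift will
    do.\<close>
  have "\<exists>c. \<forall>i. ?P i (c i) \<and> ?Q i (c i) (c (Suc i))"
  proof (rule dependent_nat_choice)
    show "\<exists>x. ?P 0 x" by simp
    fix x i assume x: "?P i x"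
    show "\<exists>y. ?P (Suc i) y \<and> ?Q i x y"
    proof (cases "Suc i < n")
      case False
      then show ?thesis by auto
    next
      case True
      then obtain y where y: "y \<in> PIN" "rho (coeff y) = \<pi> (s_gen (Suc i))"
        using assms[of "Suc i"] by auto
      show ?thesis
      proof (cases "1 \<le> i")
        case False
        then show ?thesis using y by auto
      next
        case i: True
        have x: "x \<in> PIN" "rho (coeff x) = \<pi> (s_gen i)" using x i True by auto
        have s: "s_gen i \<in> Sym n" "s_gen (Suc i) \<in> Sym n" using i True by (auto intro: s_gen_Sym)
        have "rho (coeff (x * y * x)) = rho (coeff (y * x * y))"
          using s_gen_braid[of i] by (simp only: rho_triple[OF x(1) y(1) x(1) s(1,2,1) x(2) y(2) x(2)]
              rho_triple[OF y(1) x(1) y(1) s(2,1,2) y(2) x(2) y(2)] Suc_eq_plus1)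
        then have "x * y * x = y * x * y \<or> x * y * x = - (y * x * y)"
          by (rule rho_eq_imp[rotated 2]) (intro PIN_times x y)+
        then show ?thesis
        proof
          assume "x * y * x = y * x * y"
          then show ?thesis using y by (intro exI[of _ y]) auto
        next
          assume "x * y * x = - (y * x * y)"
          \<comment> \<open>Replacing \<open>y\<close> by \<open>- y\<close> negates the left side
            and leaves the right side unchanged.\<close>
          then show ?thesis using y by (intro exI[of _ "- y"]) (auto simp: PIN_uminus rho_uminus)
        qed
      qed
    qed
  qed
  then show thesis using that by blast
qed

text \<open>Both \<pi> and the covering applied to F are multiplicative and agree on generators, so
  induction over words gives agreement everywhere.\<close>

lemma lift_exists:
  assumes c: "\<And>i. 1 \<le> i \<Longrightarrow> i < n \<Longrightarrow> c i \<in> PIN \<and> rho (coeff (c i)) = \<pi> (s_gen i)"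
    and rel: "coxeter_relations c n"
  shows "\<exists>F. clifford_lift n \<pi> F"
proof -
  obtain F where F: "F id = 1" "\<And>i g. 1 \<le> i \<Longrightarrow> i < n \<Longrightarrow> g \<in> Sym n \<Longrightarrow> F (s_gen i \<circ> g) = c i * F g"
    "\<And>g h. g \<in> Sym n \<Longrightarrow> h \<in> Sym n \<Longrightarrow> F (g \<circ> h) = F g * F h"
    using coxeter_relations.exists_homomorphism[OF rel] by metis
  have "F g \<in> PIN \<and> rho (coeff (F g)) = \<pi> g" if "g \<in> Sym n" for g
    using that
  proof (induction rule: Sym_induct)
    case id
    show ?case by (simp only: F(1) PIN.one rho_one pi_id simp_thms)
  next
    case (step i g)
    then show ?case using c[of i]
      by (simp only: F(2) PIN_times rho_times pi_comp s_gen_Sym simp_thms)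
  qed
  then show ?thesis using F(3) unfolding clifford_lift_def by blast
qed

lemma clifford_lift_simps:
  assumes "clifford_lift n \<pi> F"
  shows "g \<in> Sym n \<Longrightarrow> F g \<in> PIN" "g \<in> Sym n \<Longrightarrow> rho (coeff (F g)) = \<pi> g"
    "g \<in> Sym n \<Longrightarrow> h \<in> Sym n \<Longrightarrow> F (g \<circ> h) = F g * F h" "F id = 1"
proof -
  show *: "g \<in> Sym n \<Longrightarrow> F g \<in> PIN" "g \<in> Sym n \<Longrightarrow> rho (coeff (F g)) = \<pi> g"
    "g \<in> Sym n \<Longrightarrow> h \<in> Sym n \<Longrightarrow> F (g \<circ> h) = F g * F h" for g h
    using assms by (simp_all add: clifford_lift_def)
  have "F id * F id = F id * 1" using *(3)[OF Sym_id Sym_id] by simp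
  then show "F id = 1" by (simp only: PIN_cancel(1)[OF *(1)[OF Sym_id]])
qed

lemma multiplicities:
  obtains k l where "character \<pi> id - character \<pi> (s_gen 1) = 2 * real k"
    "character \<pi> id - character \<pi> (s_gen 1 \<circ> s_gen 3) = 2 * real l"
    "spinorial n \<pi> \<longleftrightarrow> (k mod 4 = 0 \<or> k mod 4 = 3) \<and> l mod 4 = 0"
proof -
  show thesis
  proof (rule s_gen_lift, rule s_gen_pair_lift)
    fix k l
    assume k: "character \<pi> id - character \<pi> (s_gen 1) = 2 * real k"
    "\<And>i. 1 \<le> i \<Longrightarrow> i < n \<Longrightarrow> \<exists>x\<in>PIN. rho (coeff x) = \<pi> (s_gen i)"
    "\<And>i y. 1 \<le> i \<Longrightarrow> i < n \<Longrightarrow> y \<in> PIN \<Longrightarrow> rho (coeff y) = \<pi> (s_gen i) \<Longrightarrow>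
      y * y = (-1) ^ (k * (k + 1) div 2) \<and> alpha y = (-1) ^ k * y"
      and l: "character \<pi> id - character \<pi> (s_gen 1 \<circ> s_gen 3) = 2 * real l"
    "\<And>i j y. 1 \<le> i \<Longrightarrow> Suc i < j \<Longrightarrow> j < n \<Longrightarrow> y \<in> PIN \<Longrightarrow> rho (coeff y) = \<pi> (s_gen i \<circ> s_gen j) \<Longrightarrow>
      y * y = (-1) ^ (l * (l + 1) div 2) \<and> alpha y = (-1) ^ l * y"
    have b1: "1 \<le> (1::nat)" "1 < n" and b3: "1 \<le> (3::nat)" "3 < n" and b13: "Suc 1 < (3::nat)" using n by auto
    have "even l"
    proof -
      obtain x y where x: "x \<in> PIN" "rho (coeff x) = \<pi> (s_gen 1)" and y: "y \<in> PIN" "rho (coeff y) = \<pi> (s_gen 3)"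
        using k(2)[OF b1] k(2)[OF b3] by blast
      have xy: "x * y \<in> PIN" "rho (coeff (x * y)) = \<pi> (s_gen 1 \<circ> s_gen 3)"
        using x y by (simp_all only: PIN_times rho_times pi_comp s_gen_Sym b1 b3)
      \<comment> \<open>Both factors carry the same parity sign since s_1 and s_3 are conjugate, so
        the signs cancel; an odd \<open>l\<close> would then give xy = -xy.\<close>
      have "alpha (x * y) = ((-1) ^ k * x) * ((-1) ^ k * y)"
        unfolding alpha_times using k(3)[OF b1 x] k(3)[OF b3 y] by (simp only:)
      also have "\<dots> = x * y" by (cases "even k") simp_all
      finally have "x * y = (-1) ^ l * (x * y)"
        using l(2)[OF b1(1) b13 b3(2) xy] by (simp only:)
      then show "even l" using PIN_neq_uminus[OF xy(1)]
        by (cases "even l") (simp_all only: power_minus_odd power_one mult_minus1 simp_thms)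
    qed
    \<comment> \<open>The triangular criterion also admits residue 3, which the evenness of
      \<open>l\<close> excludes.\<close>
    then have l4: "l mod 4 = 0 \<longleftrightarrow> even (l * (l + 1) div 2)"
      unfolding even_triangular_iff by presburger
    have "(\<exists>F. clifford_lift n \<pi> F) \<longleftrightarrow> even (k * (k + 1) div 2) \<and> even (l * (l + 1) div 2)"
    proof (intro iffI)
      assume "\<exists>F. clifford_lift n \<pi> F"
      then obtain F where "clifford_lift n \<pi> F" ..
      note F = clifford_lift_simps[OF this]
      have s1: "s_gen 1 \<in> Sym n" using b1 by (rule s_gen_Sym)
      have s13: "s_gen 1 \<circ> s_gen 3 \<in> Sym n" using s1 b3 by (intro Sym_comp s_gen_Sym[of 3])
      have "F (s_gen 1) * F (s_gen 1) = 1" using s1 by (simp only: F(3,4)[symmetric] s_gen_square)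
      moreover have "F (s_gen 1 \<circ> s_gen 3) * F (s_gen 1 \<circ> s_gen 3) = 1"
        using s13 by (simp only: F(3,4)[symmetric] s_gen_pair_square[OF b13])
      ultimately show "even (k * (k + 1) div 2) \<and> even (l * (l + 1) div 2)"
        using k(3)[OF b1 F(1,2)[OF s1]] l(2)[OF b1(1) b13 b3(2) F(1,2)[OF s13]]
        by (simp only: minus_one_power_eq_one_iff[where 'd='d, symmetric])
    next
      assume ev: "even (k * (k + 1) div 2) \<and> even (l * (l + 1) div 2)"
      show "\<exists>F. clifford_lift n \<pi> F"
      proof (rule exists_braided_lifts)
        show "\<exists>x\<in>PIN. rho (coeff x) = \<pi> (s_gen i)" if "1 \<le> i" "i < n" for i
          using that by (rule k(2))
      next
        fix c assume c: "\<And>i. 1 \<le> i \<Longrightarrow> i < n \<Longrightarrow> c i \<in> PIN \<and> rho (coeff (c i)) = \<pi> (s_gen i)"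
          and br: "\<And>i. 1 \<le> i \<Longrightarrow> Suc i < n \<Longrightarrow> c i * c (Suc i) * c i = c (Suc i) * c i * c (Suc i)"
        have sq: "c i * c i = 1" if "1 \<le> i" "i < n" for i
        proof -
          have "c i * c i = (-1) ^ (k * (k + 1) div 2)"
            using k(3)[OF that] c[OF that] by blast
          also have "\<dots> = 1" unfolding minus_one_power_eq_one_iff using ev by blast
          finally show ?thesis .
        qed
        have "coxeter_relations c n"
        proof
          fix i j assume ij: "1 \<le> i" "Suc i < j" "j < n"
          then have i: "1 \<le> i" "i < n" and j: "1 \<le> j" "j < n" by auto
          have xy: "c i * c j \<in> PIN" "rho (coeff (c i * c j)) = \<pi> (s_gen i \<circ> s_gen j)"
            using c[OF i] c[OF j] by (simp_all only: PIN_times rho_times pi_comp s_gen_Sym i j)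
          have "(c i * c j) * (c i * c j) = (-1) ^ (l * (l + 1) div 2)"
            using l(2)[OF ij xy] by blast
          also have "\<dots> = 1" unfolding minus_one_power_eq_one_iff using ev by blast
          \<comment> \<open>Since generators square to 1, the right side is also (c_i c_j)(c_j c_i);
            cancelling c_i c_j on the left leaves the commutation.\<close>
          also have "1 = c i * (c j * c j) * c i" by (simp only: sq[OF i] sq[OF j] mult_1_right)
          also have "\<dots> = (c i * c j) * (c j * c i)" by (simp only: mult.assoc)
          finally show "c i * c j = c j * c i"
            unfolding PIN_cancel(1)[OF xy(1)] .
        qed (rule sq br, assumption+)+
        then show "\<exists>F. clifford_lift n \<pi> F" by (intro lift_exists[of c] c)
      qed
    qed
    then show thesis
      by (intro that[OF k(1) l(1)]) (simp only: spinorial_iff l4 even_triangular_iff[of k])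
  qed
qed

text \<open>If two lifts agree on s_i but differ in sign on s_{i+1}, passing from one to the other
  negates only one side of the braid relation, which is impossible as no element of
  \<open>PIN\<close> equals its negative. Agreement at s_1 thus spreads to all generators.\<close>

lemma clifford_lift_unique:
  assumes F: "clifford_lift n \<pi> F" and G: "clifford_lift n \<pi> G"
    and 1: "F (s_gen 1) = G (s_gen 1)" and g: "g \<in> Sym n"
  shows "F g = G g"
proof -
  note F = clifford_lift_simps[OF F] and G = clifford_lift_simps[OF G]
  have gen: "1 \<le> i \<Longrightarrow> i < n \<Longrightarrow> F (s_gen i) = G (s_gen i)" for i
  proof (induction i rule: nat_induct_at_least)
    case base
    show ?case by (rule 1)
  next
    case (Suc i)
    then have s: "s_gen i \<in> Sym n" "s_gen (Suc i) \<in> Sym n" by (auto intro: s_gen_Sym)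
    define x y z where "x = F (s_gen i)" and "y = F (s_gen (Suc i))" and "z = G (s_gen (Suc i))"
    have x: "x = G (s_gen i)" using Suc by (simp add: x_def)
    have P: "x \<in> PIN" "y \<in> PIN" "z \<in> PIN" using s F G by (auto simp: x_def y_def z_def)
    have "y = z \<or> y = - z"
      using s F G P by (intro rho_eq_imp) (auto simp: y_def z_def)
    moreover have "y \<noteq> - z"
    proof
      assume yz: "y = - z"
      have b: "s_gen i \<circ> s_gen (Suc i) \<circ> s_gen i = s_gen (Suc i) \<circ> s_gen i \<circ> s_gen (Suc i)"
        using s_gen_braid[of i] by (simp only: Suc_eq_plus1)
      have "x * y * x = y * x * y"
        using s unfolding x_def y_def by (simp only: F(3)[symmetric] Sym_comp b)
      moreover have "x * z * x = z * x * z"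
        using s unfolding x z_def by (simp only: G(3)[symmetric] Sym_comp b)
      ultimately have "z * x * z = - (z * x * z)" by (simp add: yz)
      then show False using PIN_neq_uminus P by (meson PIN_times)
    qed
    ultimately show ?case by (simp add: y_def z_def)
  qed
  show ?thesis
    using g
  proof (induction rule: Sym_induct)
    case id
    show ?case by (simp only: F(4) G(4))
  next
    case (step i g)
    then show ?case by (simp only: F(3) G(3) s_gen_Sym gen)
  qed
qed

lemma clifford_lift_sign:
  assumes "clifford_lift n \<pi> F"
  shows "clifford_lift n \<pi> (\<lambda>g. if sign g = 1 then F g else - F g)" (is "clifford_lift n \<pi> ?G")
proof -
  note F = clifford_lift_simps[OF assms]
  have perm: "permutation g" if "g \<in> Sym n" for g
    using that unfolding Sym_def by (auto simp: permutation_permutes)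
  have "?G (g \<circ> h) = ?G g * ?G h" if "g \<in> Sym n" "h \<in> Sym n" for g h
  proof -
    have "sign (g \<circ> h) = sign g * sign h" using that by (intro sign_compose perm)
    moreover have "sign g = 1 \<or> sign g = - 1" "sign h = 1 \<or> sign h = - 1" by (auto simp: sign_def)
    ultimately show ?thesis using that by (auto simp: F(3))
  qed
  then show ?thesis
    unfolding clifford_lift_def by (auto simp: F(1,2) PIN_uminus rho_uminus)
qed

lemma card_lifts:
  assumes "spinorial n \<pi>" shows "card (lifts n \<pi>) = 2"
proof -
  obtain F where F: "clifford_lift n \<pi> F" using assms spinorial_iff by blast
  define G where "G g = (if sign g = 1 then F g else - F g)" for g
  have G: "clifford_lift n \<pi> G" unfolding G_def using F by (rule clifford_lift_sign)
  have s1: "s_gen 1 \<in> Sym n" using n by (intro s_gen_Sym) auto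
  have G1: "G (s_gen 1) = - F (s_gen 1)" by (simp add: G_def s_gen_def sign_swap_id)
  \<comment> \<open>\<open>lifts\<close> consists of functions extensional on \<open>Sym n\<close>;
    restricting removes the arbitrary values outside the group before counting.\<close>
  let ?r = "\<lambda>H. restrict (\<lambda>g. coeff (H g)) (Sym n)"
  have r_lift: "?r H \<in> lifts n \<pi>" if "clifford_lift n \<pi> H" for H
    using that unfolding is_lift_coeff[symmetric]
    by (simp add: lifts_def is_lift_def Sym_comp)
  have "lifts n \<pi> = {?r F, ?r G}"
  proof (intro equalityI subsetI)
    fix f assume f: "f \<in> lifts n \<pi>"
    define H where "H g = Clifford (f g)" for g
    have H: "clifford_lift n \<pi> H" using f by (simp add: lifts_def is_lift_iff H_def[abs_def])
    have fH: "f = ?r H"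
      using f by (auto simp: lifts_def H_def Clifford_inverse extensional_restrict)
    \<comment> \<open>Since s_1 is odd, the two candidates at s_1 are exactly the values of
      \<open>F\<close> and \<open>G\<close>.\<close>
    have "H (s_gen 1) = F (s_gen 1) \<or> H (s_gen 1) = - F (s_gen 1)"
      using clifford_lift_simps[OF H] clifford_lift_simps[OF F] s1 by (intro rho_eq_imp) simp_all
    then have "(\<forall>g\<in>Sym n. H g = F g) \<or> (\<forall>g\<in>Sym n. H g = G g)"
      using clifford_lift_unique[OF H F] clifford_lift_unique[OF H G] G1 by metis
    then show "f \<in> {?r F, ?r G}"
      unfolding fH by (auto intro!: restrict_ext)
  qed (use r_lift F G in auto)
  moreover have "?r F \<noteq> ?r G"
  proof
    assume "?r F = ?r G"
    then have "coeff (F (s_gen 1)) = coeff (G (s_gen 1))"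
      using s1 by (metis restrict_apply')
    then show False
      using G1 PIN_neq_uminus[OF clifford_lift_simps(1)[OF F s1]] by (simp add: coeff_inject)
  qed
  ultimately show ?thesis by simp
qed

end

theorem theorem3p4:
  fixes n :: nat and \<pi> :: "(nat \<Rightarrow> nat) \<Rightarrow> ((real, 'd::{finite,linorder}) vec, 'd) vec"
  assumes "n \<ge> 4" and "orth_rep n \<pi>"
  defines "g \<equiv> (character \<pi> id - character \<pi> (s_gen 1)) / 2"
      and "h \<equiv> (character \<pi> id - character \<pi> (s_gen 1 \<circ> s_gen 3)) / 2"
  shows "(spinorial n \<pi> \<longleftrightarrow> (real_cong g 0 4 \<or> real_cong g 3 4) \<and> real_cong h 0 4)
       \<and> (((real_cong g 0 4 \<or> real_cong g 3 4) \<and> real_cong h 0 4) \<longleftrightarrow>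
          ((real_cong (character \<pi> id - character \<pi> (s_gen 1)) 0 8 \<or>
            real_cong (character \<pi> id - character \<pi> (s_gen 1)) 6 8) \<and>
           real_cong (character \<pi> id - character \<pi> (s_gen 1 \<circ> s_gen 3)) 0 8))
       \<and> (spinorial n \<pi> \<longrightarrow> card (lifts n \<pi>) = 2)"
proof -
  interpret symmetric_group_rep n \<pi> by unfold_locales (rule assms)+
  obtain k l where k: "character \<pi> id - character \<pi> (s_gen 1) = 2 * real k"
    and l: "character \<pi> id - character \<pi> (s_gen 1 \<circ> s_gen 3) = 2 * real l"
    and spin: "spinorial n \<pi> \<longleftrightarrow> (k mod 4 = 0 \<or> k mod 4 = 3) \<and> l mod 4 = 0"
    by (rule multiplicities)
  have gh: "g = real k" "h = real l" by (simp_all only: g_def h_def k l)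
  \<comment> \<open>Because g and h are halves of character differences, the residues 0, 3 modulo 4
    become 0, 6 modulo 8.\<close>
  have double: "real_cong (2 * x) 0 8 \<longleftrightarrow> real_cong x 0 4" "real_cong (2 * x) 6 8 \<longleftrightarrow> real_cong x 3 4" for x
    using real_cong_double[of x 0 4] real_cong_double[of x 3 4] by simp_all
  show ?thesis
    unfolding k l gh double real_cong_nat spin[symmetric] using card_lifts by blast
qed

end
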